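(* Let $R$ be a commutative ring with $1$ and let $(A,\{\cdot,\cdot\})$ be a Poisson algebra over $R$. Then its Poisson $2$-form $$\pi_{\{\cdot,\cdot\}}\colon D_A\otimes_A D_A\to A,\qquad \pi_{\{\cdot,\cdot\}}(a\,du\otimes b\,dv)=ab\{u,v\},$$ is a $2$-cocycle in the complex $\mathrm{Alt}_A(D_{\{\cdot,\cdot\}},A)$. Moreover, $\pi_{\{\cdot,\cdot\}}$ is natural: if $\phi\colon (A,\{\cdot,\cdot\})\to(A',\{\cdot,\cdot\}')$ is a morphism of Poisson algebras over $R$ and $\phi_*\colon D_A\to D_{A'}$ is the induced map $a\,du\mapsto\phi(a)\,d\phi(u)$, then $\phi(\pi_{\{\cdot,\cdot\}}(\alpha,\beta))=\pi_{\{\cdot,\cdot\}'}(\phi_*\alpha,\phi_*\beta)$ for all $\alpha,\beta\in D_A$.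
   Context: A Poisson algebra over $R$ is a commutative $R$-algebra $A$ with a Lie bracket $\{\cdot,\cdot\}$ over $R$ satisfying $\{ab,c\}=a\{b,c\}+\{a,c\}b$. $D_A$ is the $A$-module of Kähler differentials of $A$ over $R$. $D_{\{\cdot,\cdot\}}$ denotes $D_A$ with the Lie bracket over $R$ given by $[a\,du,b\,dv]=a\{u,b\}dv+b\{a,v\}du+ab\,d\{u,v\}$ and the action on $A$ by derivations given by $(a\,du)(c)=a\{u,c\}$. For a Lie algebra $L$ over $R$ that is an $A$-module and acts on $A$ by derivations with $(a\alpha)(b)=a(\alpha(b))$ and $[\alpha,a\beta]=a[\alpha,\beta]+\alpha(a)\beta$, $\mathrm{Alt}_A(L,A)$ denotes the graded $A$-module of $A$-multilinear alternating forms on $L$ with values in $A$, with the $R$-linear differential $$(df)(\alpha_1,\dots,\alpha_n)=(-1)^n\sum_{i=1}^n(-1)^{i-1}\alpha_i\bigl(f(\alpha_1,\dots,\widehat{\alpha_i},\dots,\alpha_n)\bigr)+(-1)^n\sum_{j<k}(-1)^{j+k}f([\alpha_j,\alpha_k],\alpha_1,\dots,\widehat{\alpha_j},\dots,\widehat{\alpha_k},\dots,\alpha_n).$$ *)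

theory Defs
  imports "HOL-Algebra.Module" "HOL-Algebra.QuotRing"
begin

section \<open>Modules given by generators and relations\<close>

text \<open>The ring fields \<open>mult\<close> and \<open>one\<close> that the record type of modules inherits play no role
  for a module; they are left unspecified.\<close>

text \<open>Finite formal linear combinations of elements of \<open>S\<close>, as coefficient functions vanishing
  outside a finite subset of \<open>S\<close>.\<close>

definition free_module :: "('a, 'm) ring_scheme \<Rightarrow> 's set \<Rightarrow> ('a, 's \<Rightarrow> 'a) module" where
  "free_module A S =
    \<lparr>carrier = {f. (\<forall>s. f s \<in> carrier A) \<and> finite {s. f s \<noteq> \<zero>\<^bsub>A\<^esub>} \<and> {s. f s \<noteq> \<zero>\<^bsub>A\<^esub>} \<subseteq> S},
     mult = undefined, one = undefined,
     zero = (\<lambda>s. \<zero>\<^bsub>A\<^esub>), add = (\<lambda>f g s. f s \<oplus>\<^bsub>A\<^esub> g s),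
     smult = (\<lambda>a f s. a \<otimes>\<^bsub>A\<^esub> f s)\<rparr>"

definition free_gen :: "('a, 'm) ring_scheme \<Rightarrow> 's \<Rightarrow> 's \<Rightarrow> 'a" where
  "free_gen A s = (\<lambda>t. if t = s then \<one>\<^bsub>A\<^esub> else \<zero>\<^bsub>A\<^esub>)"

definition submodule_gen ::
  "('a, 'm) ring_scheme \<Rightarrow> ('a, 'x, 'k) module_scheme \<Rightarrow> 'x set \<Rightarrow> 'x set" where
  "submodule_gen A M X = \<Inter>{H. submodule H A M \<and> X \<subseteq> H}"

definition quot_module :: "('a, 'x, 'k) module_scheme \<Rightarrow> 'x set \<Rightarrow> ('a, 'x set) module" where
  "quot_module M N =
    \<lparr>carrier = a_rcosets\<^bsub>M\<^esub> N,
     mult = undefined, one = undefined,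
     zero = N, add = (\<lambda>X Y. X <+>\<^bsub>M\<^esub> Y),
     smult = (\<lambda>a X. \<Union>x\<in>X. N +>\<^bsub>M\<^esub> (a \<odot>\<^bsub>M\<^esub> x))\<rparr>"

definition presented_module ::
  "('a, 'm) ring_scheme \<Rightarrow> 's set \<Rightarrow> ('s \<Rightarrow> 'a) set \<Rightarrow> ('a, ('s \<Rightarrow> 'a) set) module" where
  "presented_module A S Q =
    quot_module (free_module A S) (submodule_gen A (free_module A S) Q)"

definition presented_gen ::
  "('a, 'm) ring_scheme \<Rightarrow> 's set \<Rightarrow> ('s \<Rightarrow> 'a) set \<Rightarrow> 's \<Rightarrow> ('s \<Rightarrow> 'a) set" where
  "presented_gen A S Q s =
    submodule_gen A (free_module A S) Q +>\<^bsub>free_module A S\<^esub> free_gen A s"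


section \<open>Tensor products\<close>

definition tensor_relations :: "('a, 'm) ring_scheme \<Rightarrow> ('a, 'x, 'k) module_scheme \<Rightarrow>
    ('a, 'y, 'l) module_scheme \<Rightarrow> ('x \<times> 'y \<Rightarrow> 'a) set" where
  "tensor_relations A M N =
    (let F = free_module A (carrier M \<times> carrier N); e = free_gen A in
      {e (x \<oplus>\<^bsub>M\<^esub> x', y) \<ominus>\<^bsub>F\<^esub> (e (x, y) \<oplus>\<^bsub>F\<^esub> e (x', y)) | x x' y.
        x \<in> carrier M \<and> x' \<in> carrier M \<and> y \<in> carrier N} \<union>
      {e (x, y \<oplus>\<^bsub>N\<^esub> y') \<ominus>\<^bsub>F\<^esub> (e (x, y) \<oplus>\<^bsub>F\<^esub> e (x, y')) | x y y'.
        x \<in> carrier M \<and> y \<in> carrier N \<and> y' \<in> carrier N} \<union>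
      {e (a \<odot>\<^bsub>M\<^esub> x, y) \<ominus>\<^bsub>F\<^esub> a \<odot>\<^bsub>F\<^esub> e (x, y) | a x y.
        a \<in> carrier A \<and> x \<in> carrier M \<and> y \<in> carrier N} \<union>
      {e (x, a \<odot>\<^bsub>N\<^esub> y) \<ominus>\<^bsub>F\<^esub> a \<odot>\<^bsub>F\<^esub> e (x, y) | a x y.
        a \<in> carrier A \<and> x \<in> carrier M \<and> y \<in> carrier N})"

definition tensor_module :: "('a, 'm) ring_scheme \<Rightarrow> ('a, 'x, 'k) module_scheme \<Rightarrow>
    ('a, 'y, 'l) module_scheme \<Rightarrow> ('a, ('x \<times> 'y \<Rightarrow> 'a) set) module" where
  "tensor_module A M N = presented_module A (carrier M \<times> carrier N) (tensor_relations A M N)"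

definition tensor :: "('a, 'm) ring_scheme \<Rightarrow> ('a, 'x, 'k) module_scheme \<Rightarrow>
    ('a, 'y, 'l) module_scheme \<Rightarrow> 'x \<Rightarrow> 'y \<Rightarrow> ('x \<times> 'y \<Rightarrow> 'a) set" where
  "tensor A M N x y = presented_gen A (carrier M \<times> carrier N) (tensor_relations A M N) (x, y)"


section \<open>Kaehler differentials\<close>

text \<open>\<open>A\<close> is an \<open>R\<close>-algebra. The relations make \<open>d\<close> additive, \<open>R\<close>-linear and a derivation.\<close>

definition kahler_relations ::
  "('r, 'm) ring_scheme \<Rightarrow> ('r, 'a, 'n) module_scheme \<Rightarrow> ('a \<Rightarrow> 'a) set" where
  "kahler_relations R A =
    (let F = free_module A (carrier A); e = free_gen A in
      {e (u \<oplus>\<^bsub>A\<^esub> v) \<ominus>\<^bsub>F\<^esub> (e u \<oplus>\<^bsub>F\<^esub> e v) | u v. u \<in> carrier A \<and> v \<in> carrier A} \<union>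
      {e (r \<odot>\<^bsub>A\<^esub> u) \<ominus>\<^bsub>F\<^esub> (r \<odot>\<^bsub>A\<^esub> \<one>\<^bsub>A\<^esub>) \<odot>\<^bsub>F\<^esub> e u | r u. r \<in> carrier R \<and> u \<in> carrier A} \<union>
      {e (u \<otimes>\<^bsub>A\<^esub> v) \<ominus>\<^bsub>F\<^esub> (u \<odot>\<^bsub>F\<^esub> e v \<oplus>\<^bsub>F\<^esub> v \<odot>\<^bsub>F\<^esub> e u) | u v.
        u \<in> carrier A \<and> v \<in> carrier A})"

definition kahler ::
  "('r, 'm) ring_scheme \<Rightarrow> ('r, 'a, 'n) module_scheme \<Rightarrow> ('a, ('a \<Rightarrow> 'a) set) module" where
  "kahler R A = presented_module A (carrier A) (kahler_relations R A)"

definition kahler_d ::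
  "('r, 'm) ring_scheme \<Rightarrow> ('r, 'a, 'n) module_scheme \<Rightarrow> 'a \<Rightarrow> ('a \<Rightarrow> 'a) set" where
  "kahler_d R A u = presented_gen A (carrier A) (kahler_relations R A) u"


section \<open>Poisson algebras\<close>

locale lie_algebra = module R L for R (structure) and L (structure) +
  fixes br :: "'c \<Rightarrow> 'c \<Rightarrow> 'c"
  assumes br_closed: "\<lbrakk>x \<in> carrier L; y \<in> carrier L\<rbrakk> \<Longrightarrow> br x y \<in> carrier L"
    and br_add_left: "\<lbrakk>x \<in> carrier L; x' \<in> carrier L; y \<in> carrier L\<rbrakk> \<Longrightarrow>
      br (x \<oplus>\<^bsub>L\<^esub> x') y = br x y \<oplus>\<^bsub>L\<^esub> br x' y"
    and br_add_right: "\<lbrakk>x \<in> carrier L; y \<in> carrier L; y' \<in> carrier L\<rbrakk> \<Longrightarrow>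
      br x (y \<oplus>\<^bsub>L\<^esub> y') = br x y \<oplus>\<^bsub>L\<^esub> br x y'"
    and br_smult_left: "\<lbrakk>r \<in> carrier R; x \<in> carrier L; y \<in> carrier L\<rbrakk> \<Longrightarrow>
      br (r \<odot>\<^bsub>L\<^esub> x) y = r \<odot>\<^bsub>L\<^esub> br x y"
    and br_smult_right: "\<lbrakk>r \<in> carrier R; x \<in> carrier L; y \<in> carrier L\<rbrakk> \<Longrightarrow>
      br x (r \<odot>\<^bsub>L\<^esub> y) = r \<odot>\<^bsub>L\<^esub> br x y"
    and br_self: "x \<in> carrier L \<Longrightarrow> br x x = \<zero>\<^bsub>L\<^esub>"
    and br_jacobi: "\<lbrakk>x \<in> carrier L; y \<in> carrier L; z \<in> carrier L\<rbrakk> \<Longrightarrow>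
      br x (br y z) \<oplus>\<^bsub>L\<^esub> br y (br z x) \<oplus>\<^bsub>L\<^esub> br z (br x y) = \<zero>\<^bsub>L\<^esub>"

locale poisson_algebra = algebra R A + lie_algebra R A br
  for R (structure) and A (structure) and br +
  assumes br_leibniz: "\<lbrakk>a \<in> carrier A; b \<in> carrier A; c \<in> carrier A\<rbrakk> \<Longrightarrow>
      br (a \<otimes>\<^bsub>A\<^esub> b) c = a \<otimes>\<^bsub>A\<^esub> br b c \<oplus>\<^bsub>A\<^esub> br a c \<otimes>\<^bsub>A\<^esub> b"

definition poisson_hom :: "('r, 'm) ring_scheme \<Rightarrow> ('r, 'a, 'n) module_scheme \<Rightarrow> ('a \<Rightarrow> 'a \<Rightarrow> 'a) \<Rightarrow>
    ('r, 'b, 'k) module_scheme \<Rightarrow> ('b \<Rightarrow> 'b \<Rightarrow> 'b) \<Rightarrow> ('a \<Rightarrow> 'b) set" where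
  "poisson_hom R A br A' br' = {\<phi> \<in> ring_hom A A'.
     (\<forall>r\<in>carrier R. \<forall>a\<in>carrier A. \<phi> (r \<odot>\<^bsub>A\<^esub> a) = r \<odot>\<^bsub>A'\<^esub> \<phi> a) \<and>
     (\<forall>a\<in>carrier A. \<forall>b\<in>carrier A. \<phi> (br a b) = br' (\<phi> a) (\<phi> b))}"


section \<open>Alternating forms\<close>

record ('a, 'l) lie_module = "('a, 'l) module" +
  lbracket :: "'l \<Rightarrow> 'l \<Rightarrow> 'l"
  laction :: "'l \<Rightarrow> 'a \<Rightarrow> 'a"

text \<open>An \<open>n\<close>-form takes the list of its \<open>n\<close> arguments, and is undefined on all other lists.\<close>

definition tuples :: "('a, 'l, 'k) module_scheme \<Rightarrow> nat \<Rightarrow> 'l list set" where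
  "tuples L n = {xs. length xs = n \<and> set xs \<subseteq> carrier L}"

definition multilinear :: "('r, 'a, 'n) module_scheme \<Rightarrow> ('a, 'l, 'k) module_scheme \<Rightarrow> nat \<Rightarrow>
    ('l list \<Rightarrow> 'a) \<Rightarrow> bool" where
  "multilinear A L n f \<longleftrightarrow> (\<forall>xs\<in>tuples L n. \<forall>i<n.
     (\<forall>x\<in>carrier L. \<forall>y\<in>carrier L. f (xs[i := x \<oplus>\<^bsub>L\<^esub> y]) = f (xs[i := x]) \<oplus>\<^bsub>A\<^esub> f (xs[i := y])) \<and>
     (\<forall>a\<in>carrier A. \<forall>x\<in>carrier L. f (xs[i := a \<odot>\<^bsub>L\<^esub> x]) = a \<otimes>\<^bsub>A\<^esub> f (xs[i := x])))"

definition alternating :: "('r, 'a, 'n) module_scheme \<Rightarrow> ('a, 'l, 'k) module_scheme \<Rightarrow> nat \<Rightarrow>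
    ('l list \<Rightarrow> 'a) \<Rightarrow> bool" where
  "alternating A L n f \<longleftrightarrow> (\<forall>xs\<in>tuples L n. \<not> distinct xs \<longrightarrow> f xs = \<zero>\<^bsub>A\<^esub>)"

text \<open>\<open>alt_forms A L n\<close> is the degree \<open>n\<close> part of the graded \<open>A\<close>-module of alternating forms.\<close>

definition alt_forms :: "('r, 'a, 'n) module_scheme \<Rightarrow> ('a, 'l, 'k) module_scheme \<Rightarrow> nat \<Rightarrow>
    ('a, 'l list \<Rightarrow> 'a) module" where
  "alt_forms A L n =
    \<lparr>carrier = {f \<in> tuples L n \<rightarrow>\<^sub>E carrier A. multilinear A L n f \<and> alternating A L n f},
     mult = undefined, one = undefined,
     zero = (\<lambda>xs\<in>tuples L n. \<zero>\<^bsub>A\<^esub>),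
     add = (\<lambda>f g. \<lambda>xs\<in>tuples L n. f xs \<oplus>\<^bsub>A\<^esub> g xs),
     smult = (\<lambda>a f. \<lambda>xs\<in>tuples L n. a \<otimes>\<^bsub>A\<^esub> f xs)\<rparr>"

definition omit :: "nat \<Rightarrow> 'l list \<Rightarrow> 'l list" where
  "omit i xs = take i xs @ drop (Suc i) xs"

definition signed :: "('a, 'm) ring_scheme \<Rightarrow> nat \<Rightarrow> 'a \<Rightarrow> 'a" where
  "signed A k a = ((\<ominus>\<^bsub>A\<^esub> \<one>\<^bsub>A\<^esub>) [^]\<^bsub>A\<^esub> k) \<otimes>\<^bsub>A\<^esub> a"

text \<open>The differential from \<open>(n - 1)\<close>-forms to \<open>n\<close>-forms, for \<open>n \<ge> 1\<close>, with the overall sign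
  \<open>(-1)^n\<close>. List positions count from \<open>0\<close>: the usual sign \<open>(-1)^(i-1)\<close> becomes \<open>(-1)^i\<close>, and
  \<open>(-1)^(j+k)\<close> stays as it is. Since \<open>j < k\<close>, removing the entry \<open>k\<close> first does not move the
  entry \<open>j\<close>.\<close>

definition alt_diff :: "('r, 'a, 'n) module_scheme \<Rightarrow> ('a, 'l, 'k) lie_module_scheme \<Rightarrow> nat \<Rightarrow>
    ('l list \<Rightarrow> 'a) \<Rightarrow> 'l list \<Rightarrow> 'a" where
  "alt_diff A L n f = (\<lambda>xs\<in>tuples L n.
     signed A n (\<Oplus>\<^bsub>A\<^esub>i\<in>{..<n}. signed A i (laction L (xs ! i) (f (omit i xs)))) \<oplus>\<^bsub>A\<^esub>
     signed A n (\<Oplus>\<^bsub>A\<^esub>k\<in>{..<n}. \<Oplus>\<^bsub>A\<^esub>j\<in>{..<k}.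
       signed A (j + k) (f (lbracket L (xs ! j) (xs ! k) # omit j (omit k xs)))))"

definition alt_cocycles :: "('r, 'a, 'n) module_scheme \<Rightarrow> ('a, 'l, 'k) lie_module_scheme \<Rightarrow> nat \<Rightarrow>
    ('l list \<Rightarrow> 'a) set" where
  "alt_cocycles A L n =
    {f \<in> carrier (alt_forms A L n). alt_diff A L (Suc n) f = \<zero>\<^bsub>alt_forms A L (Suc n)\<^esub>}"


section \<open>The Lie algebra structure on the differentials of a Poisson algebra\<close>

text \<open>The maps below are prescribed on the elements \<open>a du\<close>, which generate the differentials
  additively; there is at most one additive map with prescribed values on them. The ring \<open>R\<close> acts
  on an \<open>A\<close>-module through \<open>r \<mapsto> r \<odot> 1\<close>.\<close>

definition kahler_bracket :: "('r, 'm) ring_scheme \<Rightarrow> ('r, 'a, 'n) module_scheme \<Rightarrow>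
    ('a \<Rightarrow> 'a \<Rightarrow> 'a) \<Rightarrow> ('a \<Rightarrow> 'a) set \<Rightarrow> ('a \<Rightarrow> 'a) set \<Rightarrow> ('a \<Rightarrow> 'a) set" where
  "kahler_bracket R A br = (let D = kahler R A; d = kahler_d R A in
    THE \<beta>. \<beta> \<in> carrier D \<rightarrow>\<^sub>E carrier D \<rightarrow>\<^sub>E carrier D \<and>
      (\<forall>x\<in>carrier D. \<forall>x'\<in>carrier D. \<forall>y\<in>carrier D. \<beta> (x \<oplus>\<^bsub>D\<^esub> x') y = \<beta> x y \<oplus>\<^bsub>D\<^esub> \<beta> x' y) \<and>
      (\<forall>x\<in>carrier D. \<forall>y\<in>carrier D. \<forall>y'\<in>carrier D. \<beta> x (y \<oplus>\<^bsub>D\<^esub> y') = \<beta> x y \<oplus>\<^bsub>D\<^esub> \<beta> x y') \<and>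
      (\<forall>r\<in>carrier R. \<forall>x\<in>carrier D. \<forall>y\<in>carrier D.
        \<beta> ((r \<odot>\<^bsub>A\<^esub> \<one>\<^bsub>A\<^esub>) \<odot>\<^bsub>D\<^esub> x) y = (r \<odot>\<^bsub>A\<^esub> \<one>\<^bsub>A\<^esub>) \<odot>\<^bsub>D\<^esub> \<beta> x y \<and>
        \<beta> x ((r \<odot>\<^bsub>A\<^esub> \<one>\<^bsub>A\<^esub>) \<odot>\<^bsub>D\<^esub> y) = (r \<odot>\<^bsub>A\<^esub> \<one>\<^bsub>A\<^esub>) \<odot>\<^bsub>D\<^esub> \<beta> x y) \<and>
      (\<forall>a\<in>carrier A. \<forall>u\<in>carrier A. \<forall>b\<in>carrier A. \<forall>v\<in>carrier A.
        \<beta> (a \<odot>\<^bsub>D\<^esub> d u) (b \<odot>\<^bsub>D\<^esub> d v) =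
          (a \<otimes>\<^bsub>A\<^esub> br u b) \<odot>\<^bsub>D\<^esub> d v \<oplus>\<^bsub>D\<^esub> (b \<otimes>\<^bsub>A\<^esub> br a v) \<odot>\<^bsub>D\<^esub> d u \<oplus>\<^bsub>D\<^esub> (a \<otimes>\<^bsub>A\<^esub> b) \<odot>\<^bsub>D\<^esub> d (br u v)))"

definition kahler_action :: "('r, 'm) ring_scheme \<Rightarrow> ('r, 'a, 'n) module_scheme \<Rightarrow>
    ('a \<Rightarrow> 'a \<Rightarrow> 'a) \<Rightarrow> ('a \<Rightarrow> 'a) set \<Rightarrow> 'a \<Rightarrow> 'a" where
  "kahler_action R A br = (let D = kahler R A; d = kahler_d R A in
    THE \<rho>. \<rho> \<in> carrier D \<rightarrow>\<^sub>E carrier A \<rightarrow>\<^sub>E carrier A \<and>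
      (\<forall>x\<in>carrier D. \<forall>y\<in>carrier D. \<forall>c\<in>carrier A. \<rho> (x \<oplus>\<^bsub>D\<^esub> y) c = \<rho> x c \<oplus>\<^bsub>A\<^esub> \<rho> y c) \<and>
      (\<forall>a\<in>carrier A. \<forall>x\<in>carrier D. \<forall>c\<in>carrier A. \<rho> (a \<odot>\<^bsub>D\<^esub> x) c = a \<otimes>\<^bsub>A\<^esub> \<rho> x c) \<and>
      (\<forall>a\<in>carrier A. \<forall>u\<in>carrier A. \<forall>c\<in>carrier A. \<rho> (a \<odot>\<^bsub>D\<^esub> d u) c = a \<otimes>\<^bsub>A\<^esub> br u c))"

definition kahler_lie :: "('r, 'm) ring_scheme \<Rightarrow> ('r, 'a, 'n) module_scheme \<Rightarrow>
    ('a \<Rightarrow> 'a \<Rightarrow> 'a) \<Rightarrow> ('a, ('a \<Rightarrow> 'a) set) lie_module" where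
  "kahler_lie R A br = (let D = kahler R A in
    \<lparr>carrier = carrier D, mult = mult D, one = one D, zero = zero D, add = add D, smult = smult D,
     lbracket = kahler_bracket R A br, laction = kahler_action R A br\<rparr>)"

definition kahler_map :: "('r, 'm) ring_scheme \<Rightarrow> ('r, 'a, 'n) module_scheme \<Rightarrow>
    ('r, 'b, 'k) module_scheme \<Rightarrow> ('a \<Rightarrow> 'b) \<Rightarrow> ('a \<Rightarrow> 'a) set \<Rightarrow> ('b \<Rightarrow> 'b) set" where
  "kahler_map R A A' \<phi> =
    (let D = kahler R A; d = kahler_d R A; D' = kahler R A'; d' = kahler_d R A' in
    THE F. F \<in> carrier D \<rightarrow>\<^sub>E carrier D' \<and>
      (\<forall>x\<in>carrier D. \<forall>y\<in>carrier D. F (x \<oplus>\<^bsub>D\<^esub> y) = F x \<oplus>\<^bsub>D'\<^esub> F y) \<and>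
      (\<forall>a\<in>carrier A. \<forall>u\<in>carrier A. F (a \<odot>\<^bsub>D\<^esub> d u) = \<phi> a \<odot>\<^bsub>D'\<^esub> d' (\<phi> u)))"


section \<open>The Poisson 2-form\<close>

abbreviation kahler_tensor where
  "kahler_tensor R A \<equiv> tensor_module A (kahler R A) (kahler R A)"

abbreviation ktensor where
  "ktensor R A \<equiv> tensor A (kahler R A) (kahler R A)"

definition is_poisson_form :: "('r, 'm) ring_scheme \<Rightarrow> ('r, 'a, 'n) module_scheme \<Rightarrow>
    ('a \<Rightarrow> 'a \<Rightarrow> 'a) \<Rightarrow> (((('a \<Rightarrow> 'a) set \<times> ('a \<Rightarrow> 'a) set) \<Rightarrow> 'a) set \<Rightarrow> 'a) \<Rightarrow> bool" where
  "is_poisson_form R A br p \<longleftrightarrow> (let D = kahler R A; d = kahler_d R A; T = kahler_tensor R A in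
      p \<in> carrier T \<rightarrow>\<^sub>E carrier A \<and>
      (\<forall>s\<in>carrier T. \<forall>t\<in>carrier T. p (s \<oplus>\<^bsub>T\<^esub> t) = p s \<oplus>\<^bsub>A\<^esub> p t) \<and>
      (\<forall>a\<in>carrier A. \<forall>t\<in>carrier T. p (a \<odot>\<^bsub>T\<^esub> t) = a \<otimes>\<^bsub>A\<^esub> p t) \<and>
      (\<forall>a\<in>carrier A. \<forall>u\<in>carrier A. \<forall>b\<in>carrier A. \<forall>v\<in>carrier A.
        p (ktensor R A (a \<odot>\<^bsub>D\<^esub> d u) (b \<odot>\<^bsub>D\<^esub> d v)) = a \<otimes>\<^bsub>A\<^esub> b \<otimes>\<^bsub>A\<^esub> br u v))"

definition poisson_form :: "('r, 'm) ring_scheme \<Rightarrow> ('r, 'a, 'n) module_scheme \<Rightarrow>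
    ('a \<Rightarrow> 'a \<Rightarrow> 'a) \<Rightarrow> ((('a \<Rightarrow> 'a) set \<times> ('a \<Rightarrow> 'a) set) \<Rightarrow> 'a) set \<Rightarrow> 'a" where
  "poisson_form R A br = (THE p. is_poisson_form R A br p)"

text \<open>An \<open>A\<close>-linear map on \<open>D \<otimes> D\<close> is evaluated on a pair of differentials through
  \<open>x \<otimes> y\<close>; this makes the Poisson 2-form a 2-cochain.\<close>

definition poisson_cochain :: "('r, 'm) ring_scheme \<Rightarrow> ('r, 'a, 'n) module_scheme \<Rightarrow>
    ('a \<Rightarrow> 'a \<Rightarrow> 'a) \<Rightarrow> ('a \<Rightarrow> 'a) set list \<Rightarrow> 'a" where
  "poisson_cochain R A br = (\<lambda>xs\<in>tuples (kahler R A) 2.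
     poisson_form R A br (ktensor R A (xs ! 0) (xs ! 1)))"

end

theory Submission
  imports Defs
begin

text \<open>
  Every object of the theorem (the Lie algebra action of \<open>D\<close> on \<open>A\<close>, the bracket on \<open>D\<close>, the induced
  map on differentials, the 2-form) is prescribed on the elements \<open>a du\<close>. These generate \<open>D\<close>
  additively, so two additive maps that agree on them are equal (\<open>kahler_additive_eqI\<close>). This
  settles all uniqueness questions, and it reduces every identity between multiadditive expressions
  to a computation with elements \<open>a du\<close>. What remains is existence.

  \<^item> The action comes from the universal property of \<open>D\<close> (\<open>kahler_lift\<close>): for fixed \<open>c\<close> the map
    \<open>u \<mapsto> {u, c}\<close> is a derivation, hence extends \<open>A\<close>-linearly to \<open>D\<close>.

  \<^item> For fixed \<open>x\<close> in \<open>D\<close> the action of \<open>x\<close> is a derivation of \<open>A\<close>, hence itself extends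
    \<open>A\<close>-linearly to \<open>D\<close>. The result is bilinear with value \<open>a b {u, v}\<close> at \<open>(a du, b dv)\<close>, and the
    universal property of the tensor product turns it into the 2-form.

  \<^item> The bracket is only \<open>R\<close>-bilinear: \<open>[x, b y] = b [x, y] + x(b) y\<close>. Additive maps \<open>l\<close> on \<open>D\<close> with
    \<open>l(a x) = a l(x) + X(a) x\<close>, for a derivation \<open>X\<close> of \<open>A\<close>, become linear after twisting:
    \<open>x \<mapsto> (x, l x)\<close> is \<open>A\<close>-linear into \<open>D \<times> D\<close> with the action \<open>a (x, y) = (a x, a y + X(a) x)\<close>. So the
    universal property produces them as well (\<open>kahler_twisted_lift\<close>). It is used twice: with
    \<open>X = {\<cdot>, v}\<close> to define \<open>[x, dv]\<close>, and then with \<open>X\<close> the action of \<open>x\<close> to define \<open>[x, \<cdot>]\<close>.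

  On the elements \<open>a du\<close>, \<open>b dv\<close>, \<open>c dw\<close> the coboundary of the 2-form consists of terms with
  coefficient \<open>a b c\<close>, which cancel by the Jacobi identity, and of terms that contain one bracket of
  a coefficient with \<open>u\<close>, \<open>v\<close> or \<open>w\<close>, which cancel in pairs (\<open>coboundary_gen\<close>). Naturality is clear
  on generators, because a morphism of Poisson algebras maps \<open>a b {u, v}\<close> to
  \<open>\<phi>(a) \<phi>(b) {\<phi>(u), \<phi>(v)}\<close>.
\<close>


section \<open>Linear maps and generated submodules\<close>

definition linear_map ::
  "('a, 'm) ring_scheme \<Rightarrow> ('a, 'x, 'k) module_scheme \<Rightarrow> ('a, 'y, 'l) module_scheme \<Rightarrow>
    ('x \<Rightarrow> 'y) \<Rightarrow> bool" where
  "linear_map A M N h \<longleftrightarrow> h \<in> carrier M \<rightarrow> carrier N \<and>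
     (\<forall>x\<in>carrier M. \<forall>y\<in>carrier M. h (x \<oplus>\<^bsub>M\<^esub> y) = h x \<oplus>\<^bsub>N\<^esub> h y) \<and>
     (\<forall>a\<in>carrier A. \<forall>x\<in>carrier M. h (a \<odot>\<^bsub>M\<^esub> x) = a \<odot>\<^bsub>N\<^esub> h x)"

lemma linear_mapD:
  assumes "linear_map A M N h"
  shows "x \<in> carrier M \<Longrightarrow> h x \<in> carrier N"
    and "x \<in> carrier M \<Longrightarrow> y \<in> carrier M \<Longrightarrow> h (x \<oplus>\<^bsub>M\<^esub> y) = h x \<oplus>\<^bsub>N\<^esub> h y"
    and "a \<in> carrier A \<Longrightarrow> x \<in> carrier M \<Longrightarrow> h (a \<odot>\<^bsub>M\<^esub> x) = a \<odot>\<^bsub>N\<^esub> h x"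
  using assms by (auto simp: linear_map_def)

lemma linear_mapI:
  assumes "\<And>x. x \<in> carrier M \<Longrightarrow> h x \<in> carrier N"
    and "\<And>x y. x \<in> carrier M \<Longrightarrow> y \<in> carrier M \<Longrightarrow> h (x \<oplus>\<^bsub>M\<^esub> y) = h x \<oplus>\<^bsub>N\<^esub> h y"
    and "\<And>a x. a \<in> carrier A \<Longrightarrow> x \<in> carrier M \<Longrightarrow> h (a \<odot>\<^bsub>M\<^esub> x) = a \<odot>\<^bsub>N\<^esub> h x"
  shows "linear_map A M N h"
  using assms by (auto simp: linear_map_def)

lemma additive_zero:
  assumes "abelian_group M" "abelian_group N"
    and "\<And>x. x \<in> carrier M \<Longrightarrow> h x \<in> carrier N"
    and "\<And>x y. x \<in> carrier M \<Longrightarrow> y \<in> carrier M \<Longrightarrow> h (x \<oplus>\<^bsub>M\<^esub> y) = h x \<oplus>\<^bsub>N\<^esub> h y"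
  shows "h \<zero>\<^bsub>M\<^esub> = \<zero>\<^bsub>N\<^esub>"
proof -
  interpret M: abelian_group M by fact
  interpret N: abelian_group N by fact
  have "h \<zero>\<^bsub>M\<^esub> \<oplus>\<^bsub>N\<^esub> h \<zero>\<^bsub>M\<^esub> = h \<zero>\<^bsub>M\<^esub>"
    using assms(4)[of "\<zero>\<^bsub>M\<^esub>" "\<zero>\<^bsub>M\<^esub>"] by simp
  then show ?thesis using assms(3)[of "\<zero>\<^bsub>M\<^esub>"] by (metis M.zero_closed N.add.r_cancel_one)
qed

lemma additive_minus:
  assumes "abelian_group M" "abelian_group N"
    and cl: "\<And>x. x \<in> carrier M \<Longrightarrow> h x \<in> carrier N"
    and add: "\<And>x y. x \<in> carrier M \<Longrightarrow> y \<in> carrier M \<Longrightarrow> h (x \<oplus>\<^bsub>M\<^esub> y) = h x \<oplus>\<^bsub>N\<^esub> h y"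
    and x: "x \<in> carrier M"
  shows "h (\<ominus>\<^bsub>M\<^esub> x) = \<ominus>\<^bsub>N\<^esub> h x"
proof -
  interpret M: abelian_group M by fact
  interpret N: abelian_group N by fact
  have "h (\<ominus>\<^bsub>M\<^esub> x) \<oplus>\<^bsub>N\<^esub> h x = \<zero>\<^bsub>N\<^esub>"
    using add[of "\<ominus>\<^bsub>M\<^esub> x" x] x additive_zero[OF assms(1-4)] by (simp add: M.l_neg)
  then show ?thesis using x cl by (metis M.a_inv_closed N.minus_equality)
qed

lemma linear_map_zero:
  assumes "module A M" "module A N" "linear_map A M N h"
  shows "h \<zero>\<^bsub>M\<^esub> = \<zero>\<^bsub>N\<^esub>"
  using assms by (intro additive_zero) (auto simp: linear_map_def module_def)

lemma linear_map_minus: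
  assumes "module A M" "module A N" "linear_map A M N h" "x \<in> carrier M" "y \<in> carrier M"
  shows "h (x \<ominus>\<^bsub>M\<^esub> y) = h x \<ominus>\<^bsub>N\<^esub> h y"
proof -
  interpret M: module A M by fact
  have "h (\<ominus>\<^bsub>M\<^esub> y) = \<ominus>\<^bsub>N\<^esub> h y"
    using assms by (intro additive_minus) (auto simp: linear_map_def module_def)
  then show ?thesis
    using assms by (simp add: a_minus_def linear_map_def)
qed

text \<open>Relations are presented as differences; this form turns the vanishing of a linear map on a relation
  into the corresponding equation.\<close>

lemma linear_map_minus_eq_zero:
  assumes "module A M" "module A N" "linear_map A M N h" "x \<in> carrier M" "y \<in> carrier M"
  shows "h (x \<ominus>\<^bsub>M\<^esub> y) = \<zero>\<^bsub>N\<^esub> \<longleftrightarrow> h x = h y"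
proof -
  interpret N: module A N by fact
  show ?thesis
    using linear_map_minus[OF assms] linear_mapD(1)[OF assms(3)] assms(4,5)
    by (metis N.M.add.inv_closed N.M.minus_eq N.M.minus_equality N.M.minus_minus N.M.r_neg)
qed

lemma kernel_submodule:
  assumes "module A M" "module A N" "linear_map A M N h"
  shows "submodule {x \<in> carrier M. h x = \<zero>\<^bsub>N\<^esub>} A M"
proof -
  interpret M: module A M by fact
  interpret N: module A N by fact
  show ?thesis
    using linear_map_zero[OF assms] linear_map_minus[OF assms M.zero_closed] assms(3)
    by (intro M.submoduleI) (auto simp: linear_map_def a_minus_def)
qed

lemma submodule_gen_submodule:
  assumes "module A M" "X \<subseteq> carrier M"
  shows "submodule (submodule_gen A M X) A M"
proof -
  interpret M: module A M by fact
  have carr: "submodule_gen A M X \<subseteq> carrier M"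
    using M.carrier_is_submodule assms(2) by (auto simp: submodule_gen_def)
  show ?thesis
  proof (rule M.submoduleI[OF carr])
    show "\<zero>\<^bsub>M\<^esub> \<in> submodule_gen A M X"
      by (auto simp: submodule_gen_def dest!: submodule.axioms(1) subgroup.one_closed)
  qed (auto simp: submodule_gen_def dest: M.submoduleE)
qed

lemma submodule_gen_incl: "X \<subseteq> submodule_gen A M X"
  by (auto simp: submodule_gen_def)

lemma submodule_gen_least:
  assumes "submodule H A M" "X \<subseteq> H"
  shows "submodule_gen A M X \<subseteq> H"
  using assms by (auto simp: submodule_gen_def)


text \<open>An \<open>R\<close>-algebra \<open>A\<close> carries the scalar multiplication by \<open>R\<close>; as the target of \<open>A\<close>-linear maps it has to
  be a module over itself.\<close>

definition regular_module :: "('a, 'm) ring_scheme \<Rightarrow> ('a, 'a) module" where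
  "regular_module A = \<lparr>carrier = carrier A, mult = mult A, one = one A, zero = zero A,
     add = add A, smult = mult A\<rparr>"

lemma regular_module_simps [simp]:
  "carrier (regular_module A) = carrier A" "\<zero>\<^bsub>regular_module A\<^esub> = \<zero>\<^bsub>A\<^esub>"
  "x \<oplus>\<^bsub>regular_module A\<^esub> y = x \<oplus>\<^bsub>A\<^esub> y" "a \<odot>\<^bsub>regular_module A\<^esub> x = a \<otimes>\<^bsub>A\<^esub> x"
  by (simp_all add: regular_module_def)

lemma regular_module_module:
  assumes "cring A"
  shows "module A (regular_module A)"
proof -
  interpret cring A by fact
  show ?thesis
  proof (rule moduleI[OF assms])
    show "abelian_group (regular_module A)"
    proof (rule abelian_groupI)
      fix x assume "x \<in> carrier (regular_module A)"
      then show "\<exists>y\<in>carrier (regular_module A). y \<oplus>\<^bsub>regular_module A\<^esub> x = \<zero>\<^bsub>regular_module A\<^esub>"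
        by (intro bexI[of _ "\<ominus>\<^bsub>A\<^esub> x"]) (auto simp: l_neg)
    qed (auto simp: a_ac)
  qed (auto simp: l_distr r_distr m_assoc)
qed


section \<open>Free modules\<close>

lemma free_module_simps [simp]:
  "\<zero>\<^bsub>free_module A S\<^esub> = (\<lambda>s. \<zero>\<^bsub>A\<^esub>)"
  "f \<oplus>\<^bsub>free_module A S\<^esub> g = (\<lambda>s. f s \<oplus>\<^bsub>A\<^esub> g s)"
  "a \<odot>\<^bsub>free_module A S\<^esub> f = (\<lambda>s. a \<otimes>\<^bsub>A\<^esub> f s)"
  by (simp_all add: free_module_def)

lemma free_module_carrier:
  "f \<in> carrier (free_module A S) \<longleftrightarrow>
    (\<forall>s. f s \<in> carrier A) \<and> finite {s. f s \<noteq> \<zero>\<^bsub>A\<^esub>} \<and> {s. f s \<noteq> \<zero>\<^bsub>A\<^esub>} \<subseteq> S"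
  by (simp add: free_module_def)

lemma free_module_module:
  assumes "cring A"
  shows "module A (free_module A S)"
proof -
  interpret cring A by fact
  have add: "(\<lambda>s. f s \<oplus>\<^bsub>A\<^esub> g s) \<in> carrier (free_module A S)"
    if "f \<in> carrier (free_module A S)" "g \<in> carrier (free_module A S)" for f g
  proof -
    have "{s. f s \<oplus>\<^bsub>A\<^esub> g s \<noteq> \<zero>\<^bsub>A\<^esub>} \<subseteq> {s. f s \<noteq> \<zero>\<^bsub>A\<^esub>} \<union> {s. g s \<noteq> \<zero>\<^bsub>A\<^esub>}" by auto
    with that show ?thesis
      unfolding free_module_carrier by (blast intro: finite_subset)
  qed
  have inv: "(\<lambda>s. \<ominus>\<^bsub>A\<^esub> f s) \<in> carrier (free_module A S)"
    if "f \<in> carrier (free_module A S)" for f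
  proof -
    have "{s. \<ominus>\<^bsub>A\<^esub> f s \<noteq> \<zero>\<^bsub>A\<^esub>} \<subseteq> {s. f s \<noteq> \<zero>\<^bsub>A\<^esub>}" by auto
    with that show ?thesis
      unfolding free_module_carrier by (blast intro: finite_subset)
  qed
  have smult: "(\<lambda>s. a \<otimes>\<^bsub>A\<^esub> f s) \<in> carrier (free_module A S)"
    if "f \<in> carrier (free_module A S)" "a \<in> carrier A" for f a
  proof -
    have "{s. a \<otimes>\<^bsub>A\<^esub> f s \<noteq> \<zero>\<^bsub>A\<^esub>} \<subseteq> {s. f s \<noteq> \<zero>\<^bsub>A\<^esub>}" using that by auto
    with that show ?thesis
      unfolding free_module_carrier by (blast intro: finite_subset)
  qed
  have carr: "f s \<in> carrier A" if "f \<in> carrier (free_module A S)" for f s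
    using that by (simp add: free_module_carrier)
  show ?thesis
  proof (rule moduleI[OF assms])
    show "abelian_group (free_module A S)"
    proof (rule abelian_groupI)
      fix f assume f: "f \<in> carrier (free_module A S)"
      show "\<exists>g\<in>carrier (free_module A S). g \<oplus>\<^bsub>free_module A S\<^esub> f = \<zero>\<^bsub>free_module A S\<^esub>"
        using inv[OF f] carr[OF f] by (intro bexI[of _ "\<lambda>s. \<ominus>\<^bsub>A\<^esub> f s"]) (auto simp: l_neg)
    qed (auto simp: add carr a_ac, simp add: free_module_carrier)
  qed (auto simp: smult carr l_distr r_distr m_assoc)
qed

lemma free_gen_closed:
  assumes "cring A" "s \<in> S"
  shows "free_gen A s \<in> carrier (free_module A S)"
proof -
  interpret cring A by fact
  have "{t. free_gen A s t \<noteq> \<zero>\<^bsub>A\<^esub>} \<subseteq> {s}" by (auto simp: free_gen_def)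
  then show ?thesis using assms(2)
    unfolding free_module_carrier by (auto simp: free_gen_def intro: finite_subset)
qed

text \<open>A finitely supported function is built up from multiples of generators by adding one point of its
  support at a time.\<close>

lemma free_module_induct [consumes 2, case_names zero add gen]:
  assumes "cring A" and f: "f \<in> carrier (free_module A S)"
    and zero: "P \<zero>\<^bsub>free_module A S\<^esub>"
    and add: "\<And>f g. \<lbrakk>f \<in> carrier (free_module A S); g \<in> carrier (free_module A S); P f; P g\<rbrakk> \<Longrightarrow>
      P (f \<oplus>\<^bsub>free_module A S\<^esub> g)"
    and gen: "\<And>a s. \<lbrakk>a \<in> carrier A; s \<in> S\<rbrakk> \<Longrightarrow> P (a \<odot>\<^bsub>free_module A S\<^esub> free_gen A s)"
  shows "P f"
proof -
  interpret cring A by fact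
  interpret F: module A "free_module A S" by (rule free_module_module) fact
  have "finite {s. f s \<noteq> \<zero>\<^bsub>A\<^esub>}" using f by (simp add: free_module_carrier)
  then show ?thesis using f
  proof (induction "{s. f s \<noteq> \<zero>\<^bsub>A\<^esub>}" arbitrary: f rule: finite_induct)
    case empty
    then have "f = \<zero>\<^bsub>free_module A S\<^esub>" by auto
    with zero show ?case by simp
  next
    case (insert s X f)
    let ?g = "f(s := \<zero>\<^bsub>A\<^esub>)"
    have supp: "X = {t. ?g t \<noteq> \<zero>\<^bsub>A\<^esub>}" using insert.hyps by auto
    have s: "s \<in> S" and fs: "f t \<in> carrier A" for t
      using insert.prems insert.hyps(4) by (auto simp: free_module_carrier)
    have g: "?g \<in> carrier (free_module A S)"
      using insert.prems insert.hyps(1) supp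
      by (auto simp: free_module_carrier)
    have "f = f s \<odot>\<^bsub>free_module A S\<^esub> free_gen A s \<oplus>\<^bsub>free_module A S\<^esub> ?g"
      using fs by (auto simp: free_gen_def)
    moreover have "P ?g" using insert.hyps(3)[OF supp g] .
    ultimately show ?case
      using add[OF _ g gen[OF fs s]] F.smult_closed[OF fs free_gen_closed[OF assms(1) s]]
      by metis
  qed
qed

lemma free_module_lift:
  assumes "module A M" and g: "g \<in> S \<rightarrow> carrier M"
  obtains h where "linear_map A (free_module A S) M h"
    and "\<And>s. s \<in> S \<Longrightarrow> h (free_gen A s) = g s"
proof -
  interpret M: module A M by fact
  let ?F = "free_module A S"
  define h where "h f = (\<Oplus>\<^bsub>M\<^esub>s\<in>{s. f s \<noteq> \<zero>\<^bsub>A\<^esub>}. f s \<odot>\<^bsub>M\<^esub> g s)" for f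
  \<comment> \<open>Adding two functions changes the support, so the sum is needed over any finite set containing it.\<close>
  have ext: "h f = (\<Oplus>\<^bsub>M\<^esub>s\<in>X. f s \<odot>\<^bsub>M\<^esub> g s)"
    if "f \<in> carrier ?F" "finite X" "{s. f s \<noteq> \<zero>\<^bsub>A\<^esub>} \<subseteq> X" "X \<subseteq> S" for f X
    unfolding h_def using that g
    by (intro M.add.finprod_mono_neutral_cong_left) (auto simp: free_module_carrier Pi_iff)
  have "linear_map A ?F M h"
  proof (rule linear_mapI)
    fix f assume f: "f \<in> carrier ?F"
    show "h f \<in> carrier M"
      unfolding h_def using f g by (intro M.finsum_closed) (auto simp: free_module_carrier)
  next
    fix f f' assume f: "f \<in> carrier ?F" "f' \<in> carrier ?F"
    let ?X = "{s. f s \<noteq> \<zero>\<^bsub>A\<^esub>} \<union> {s. f' s \<noteq> \<zero>\<^bsub>A\<^esub>}"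
    interpret F: module A ?F by (rule free_module_module) (rule M.R.is_cring)
    have X: "finite ?X" "?X \<subseteq> S" using f by (auto simp: free_module_carrier)
    have "h (f \<oplus>\<^bsub>?F\<^esub> f') = (\<Oplus>\<^bsub>M\<^esub>s\<in>?X. (f s \<oplus>\<^bsub>A\<^esub> f' s) \<odot>\<^bsub>M\<^esub> g s)"
    proof -
      have "{s. f s \<oplus>\<^bsub>A\<^esub> f' s \<noteq> \<zero>\<^bsub>A\<^esub>} \<subseteq> ?X" by auto
      then show ?thesis using ext[OF F.a_closed[OF f] X(1) _ X(2)] by simp
    qed
    also have "\<dots> = (\<Oplus>\<^bsub>M\<^esub>s\<in>?X. f s \<odot>\<^bsub>M\<^esub> g s \<oplus>\<^bsub>M\<^esub> f' s \<odot>\<^bsub>M\<^esub> g s)"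
      using f g X by (intro M.add.finprod_cong')
        (auto simp: free_module_carrier M.smult_l_distr Pi_iff subset_iff)
    also have "\<dots> = h f \<oplus>\<^bsub>M\<^esub> h f'"
      using f g X ext[OF f(1) X(1) _ X(2)] ext[OF f(2) X(1) _ X(2)]
      by (subst M.finsum_addf) (auto simp: free_module_carrier Pi_iff subset_iff)
    finally show "h (f \<oplus>\<^bsub>?F\<^esub> f') = h f \<oplus>\<^bsub>M\<^esub> h f'" .
  next
    fix a f assume a: "a \<in> carrier A" and f: "f \<in> carrier ?F"
    let ?X = "{s. f s \<noteq> \<zero>\<^bsub>A\<^esub>}"
    interpret F: module A ?F by (rule free_module_module) (rule M.R.is_cring)
    have X: "finite ?X" "?X \<subseteq> S" using f by (auto simp: free_module_carrier)
    have "h (a \<odot>\<^bsub>?F\<^esub> f) = (\<Oplus>\<^bsub>M\<^esub>s\<in>?X. (a \<otimes>\<^bsub>A\<^esub> f s) \<odot>\<^bsub>M\<^esub> g s)"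
    proof -
      have "{s. a \<otimes>\<^bsub>A\<^esub> f s \<noteq> \<zero>\<^bsub>A\<^esub>} \<subseteq> ?X" using a by auto
      then show ?thesis using ext[OF F.smult_closed[OF a f] X(1) _ X(2)] by simp
    qed
    also have "\<dots> = (\<Oplus>\<^bsub>M\<^esub>s\<in>?X. a \<odot>\<^bsub>M\<^esub> (f s \<odot>\<^bsub>M\<^esub> g s))"
      using f g X a by (intro M.add.finprod_cong')
        (auto simp: free_module_carrier M.smult_assoc1 Pi_iff subset_iff)
    also have "\<dots> = a \<odot>\<^bsub>M\<^esub> h f"
      unfolding h_def using f g X a
      by (intro M.finsum_smult_ldistr[symmetric]) (auto simp: free_module_carrier Pi_iff subset_iff)
    finally show "h (a \<odot>\<^bsub>?F\<^esub> f) = a \<odot>\<^bsub>M\<^esub> h f" .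
  qed
  moreover have "h (free_gen A s) = g s" if s: "s \<in> S" for s
  proof -
    have "h (free_gen A s) = (\<Oplus>\<^bsub>M\<^esub>t\<in>{s}. free_gen A s t \<odot>\<^bsub>M\<^esub> g t)"
      by (rule ext[OF free_gen_closed[OF M.R.is_cring s]]) (use s in \<open>auto simp: free_gen_def\<close>)
    also have "\<dots> = g s"
      using g s by (auto simp: free_gen_def Pi_iff)
    finally show ?thesis .
  qed
  ultimately show thesis using that by blast
qed


declare free_module_simps [simp del]


section \<open>Quotients and presentations\<close>

lemma submodule_abelian_subgroup:
  assumes "module A M" "submodule N A M"
  shows "abelian_subgroup N M"
  using assms by (intro abelian_subgroupI3 additive_subgroupI) (auto simp: module_def submodule_def)

lemma coset_eq_iff:
  assumes "module A M" "submodule N A M" "x \<in> carrier M" "y \<in> carrier M"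
  shows "N +>\<^bsub>M\<^esub> x = N +>\<^bsub>M\<^esub> y \<longleftrightarrow> x \<ominus>\<^bsub>M\<^esub> y \<in> N"
proof -
  interpret M: module A M by fact
  interpret N: abelian_subgroup N M using assms(1,2) by (rule submodule_abelian_subgroup)
  have "N +>\<^bsub>M\<^esub> x = N +>\<^bsub>M\<^esub> y \<longleftrightarrow> x \<in> N +>\<^bsub>M\<^esub> y"
    using assms(3,4) N.a_repr_independence' N.a_repr_independenceD by metis
  then show ?thesis
    using assms(3,4) N.a_rcos_module[of y x] by (simp add: a_minus_def)
qed

lemma quot_module_simps:
  assumes "module A M" "submodule N A M"
  shows "carrier (quot_module M N) = (\<lambda>x. N +>\<^bsub>M\<^esub> x) ` carrier M"
    and "\<zero>\<^bsub>quot_module M N\<^esub> = N +>\<^bsub>M\<^esub> \<zero>\<^bsub>M\<^esub>"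
    and "\<lbrakk>x \<in> carrier M; y \<in> carrier M\<rbrakk> \<Longrightarrow>
      (N +>\<^bsub>M\<^esub> x) \<oplus>\<^bsub>quot_module M N\<^esub> (N +>\<^bsub>M\<^esub> y) = N +>\<^bsub>M\<^esub> (x \<oplus>\<^bsub>M\<^esub> y)"
    and "\<lbrakk>a \<in> carrier A; x \<in> carrier M\<rbrakk> \<Longrightarrow>
      a \<odot>\<^bsub>quot_module M N\<^esub> (N +>\<^bsub>M\<^esub> x) = N +>\<^bsub>M\<^esub> (a \<odot>\<^bsub>M\<^esub> x)"
proof -
  interpret M: module A M by fact
  interpret N: abelian_subgroup N M using assms by (rule submodule_abelian_subgroup)
  show "carrier (quot_module M N) = (\<lambda>x. N +>\<^bsub>M\<^esub> x) ` carrier M"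
    by (auto simp: quot_module_def A_RCOSETS_def')
  show "\<zero>\<^bsub>quot_module M N\<^esub> = N +>\<^bsub>M\<^esub> \<zero>\<^bsub>M\<^esub>"
    using N.a_subset by (simp add: quot_module_def)
  show "(N +>\<^bsub>M\<^esub> x) \<oplus>\<^bsub>quot_module M N\<^esub> (N +>\<^bsub>M\<^esub> y) = N +>\<^bsub>M\<^esub> (x \<oplus>\<^bsub>M\<^esub> y)"
    if "x \<in> carrier M" "y \<in> carrier M"
    using that by (simp add: quot_module_def N.a_rcos_sum)
  show "a \<odot>\<^bsub>quot_module M N\<^esub> (N +>\<^bsub>M\<^esub> x) = N +>\<^bsub>M\<^esub> (a \<odot>\<^bsub>M\<^esub> x)"
    if a: "a \<in> carrier A" and x: "x \<in> carrier M"
  proof -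
    \<comment> \<open>All cosets in the union that defines the scalar multiple are equal.\<close>
    have "N +>\<^bsub>M\<^esub> (a \<odot>\<^bsub>M\<^esub> y) = N +>\<^bsub>M\<^esub> (a \<odot>\<^bsub>M\<^esub> x)" if y: "y \<in> N +>\<^bsub>M\<^esub> x" for y
    proof -
      have y': "y \<in> carrier M" using N.a_elemrcos_carrier[OF x y] .
      have "y \<ominus>\<^bsub>M\<^esub> x \<in> N" using N.a_rcos_module[OF x y'] y by (simp add: a_minus_def)
      then have "a \<odot>\<^bsub>M\<^esub> (y \<ominus>\<^bsub>M\<^esub> x) \<in> N" using a assms(2) by (simp add: submodule.smult_closed)
      then have "a \<odot>\<^bsub>M\<^esub> y \<ominus>\<^bsub>M\<^esub> a \<odot>\<^bsub>M\<^esub> x \<in> N"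
        using a x y' by (simp add: a_minus_def M.smult_r_distr M.smult_r_minus)
      then show ?thesis using coset_eq_iff[OF assms] a x y' by simp
    qed
    then have "a \<odot>\<^bsub>quot_module M N\<^esub> (N +>\<^bsub>M\<^esub> x) =
        (\<Union>y\<in>N +>\<^bsub>M\<^esub> x. N +>\<^bsub>M\<^esub> (a \<odot>\<^bsub>M\<^esub> x))"
      unfolding quot_module_def by simp
    moreover have "N +>\<^bsub>M\<^esub> x \<noteq> {}" using N.a_rcos_self[OF x] by blast
    ultimately show ?thesis by simp
  qed
qed

lemma quot_module_module:
  assumes "module A M" "submodule N A M"
  shows "module A (quot_module M N)"
proof -
  interpret M: module A M by fact
  note [simp] = quot_module_simps[OF assms]
  show ?thesis
  proof (rule moduleI)
    show "abelian_group (quot_module M N)"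
    proof (rule abelian_groupI)
      fix X assume "X \<in> carrier (quot_module M N)"
      then obtain x where x: "x \<in> carrier M" "X = N +>\<^bsub>M\<^esub> x" by auto
      then have "(N +>\<^bsub>M\<^esub> \<ominus>\<^bsub>M\<^esub> x) \<oplus>\<^bsub>quot_module M N\<^esub> X = \<zero>\<^bsub>quot_module M N\<^esub>"
        by (simp add: M.M.l_neg)
      then show "\<exists>Y\<in>carrier (quot_module M N). Y \<oplus>\<^bsub>quot_module M N\<^esub> X = \<zero>\<^bsub>quot_module M N\<^esub>"
        using x by (intro bexI[of _ "N +>\<^bsub>M\<^esub> \<ominus>\<^bsub>M\<^esub> x"]) simp_all
    qed (auto simp: M.M.a_ac)
  qed (auto simp: M.smult_l_distr M.smult_r_distr M.smult_assoc1 M.R.is_cring)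
qed

lemma quot_module_proj:
  assumes "module A M" "submodule N A M"
  shows "linear_map A M (quot_module M N) (\<lambda>x. N +>\<^bsub>M\<^esub> x)"
  using quot_module_simps[OF assms] by (intro linear_mapI) auto

lemma quot_module_lift:
  assumes M: "module A M" and N: "submodule N A M" and P: "module A P"
    and h: "linear_map A M P h" and zero: "\<And>x. x \<in> N \<Longrightarrow> h x = \<zero>\<^bsub>P\<^esub>"
  obtains k where "linear_map A (quot_module M N) P k"
    and "\<And>x. x \<in> carrier M \<Longrightarrow> k (N +>\<^bsub>M\<^esub> x) = h x"
proof -
  interpret M: module A M by fact
  note [simp] = quot_module_simps[OF M N]
  define k where "k X = h (inv_into (carrier M) (\<lambda>x. N +>\<^bsub>M\<^esub> x) X)" for X
  have k: "k (N +>\<^bsub>M\<^esub> x) = h x" if x: "x \<in> carrier M" for x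
  proof -
    let ?y = "inv_into (carrier M) (\<lambda>x. N +>\<^bsub>M\<^esub> x) (N +>\<^bsub>M\<^esub> x)"
    have y: "?y \<in> carrier M" "N +>\<^bsub>M\<^esub> ?y = N +>\<^bsub>M\<^esub> x"
      using inv_into_into[of "N +>\<^bsub>M\<^esub> x" "\<lambda>x. N +>\<^bsub>M\<^esub> x" "carrier M"]
        f_inv_into_f[of "N +>\<^bsub>M\<^esub> x" "\<lambda>x. N +>\<^bsub>M\<^esub> x" "carrier M"] x by simp_all
    then have "h (?y \<ominus>\<^bsub>M\<^esub> x) = \<zero>\<^bsub>P\<^esub>"
      using coset_eq_iff[OF M N] x zero by blast
    then show ?thesis
      unfolding k_def using linear_map_minus_eq_zero[OF M P h y(1) x] by simp
  qed
  moreover have "linear_map A (quot_module M N) P k"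
    using linear_mapD[OF h] k by (intro linear_mapI) auto
  ultimately show thesis using that by blast
qed

lemma presented_module_module:
  assumes "cring A" "Q \<subseteq> carrier (free_module A S)"
  shows "module A (presented_module A S Q)"
  unfolding presented_module_def
  using assms by (intro quot_module_module submodule_gen_submodule free_module_module)

text \<open>The defining relations of a presented module become equations between its generators by applying
  this projection to the two sides of a relation.\<close>

lemma presented_module_proj:
  assumes "cring A" "Q \<subseteq> carrier (free_module A S)"
  obtains p where "linear_map A (free_module A S) (presented_module A S Q) p"
    and "\<And>s. p (free_gen A s) = presented_gen A S Q s"
    and "\<And>q. q \<in> Q \<Longrightarrow> p q = \<zero>\<^bsub>presented_module A S Q\<^esub>"
    and "p ` carrier (free_module A S) = carrier (presented_module A S Q)"
proof -
  let ?F = "free_module A S"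
  let ?N = "submodule_gen A ?F Q"
  have F: "module A ?F" using assms(1) by (rule free_module_module)
  interpret F: module A ?F by fact
  have N: "submodule ?N A ?F" using F assms(2) by (rule submodule_gen_submodule)
  interpret N: abelian_subgroup ?N ?F using F N by (rule submodule_abelian_subgroup)
  show thesis
  proof (rule that)
    show "linear_map A ?F (presented_module A S Q) (\<lambda>x. ?N +>\<^bsub>?F\<^esub> x)"
      unfolding presented_module_def using F N by (rule quot_module_proj)
    show "?N +>\<^bsub>?F\<^esub> q = \<zero>\<^bsub>presented_module A S Q\<^esub>" if "q \<in> Q" for q
      using that submodule_gen_incl[of Q A ?F] N.a_rcos_const[of q]
      by (auto simp: presented_module_def quot_module_def)
  qed (simp_all add: presented_gen_def presented_module_def quot_module_simps[OF F N])
qed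

lemma presented_module_eqI:
  assumes "cring A" "Q \<subseteq> carrier (free_module A S)"
    and "linear_map A (free_module A S) (presented_module A S Q) p"
    and "\<And>q. q \<in> Q \<Longrightarrow> p q = \<zero>\<^bsub>presented_module A S Q\<^esub>"
    and "x \<in> carrier (free_module A S)" "y \<in> carrier (free_module A S)"
    and "x \<ominus>\<^bsub>free_module A S\<^esub> y \<in> Q"
  shows "p x = p y"
  using linear_map_minus_eq_zero[OF free_module_module presented_module_module] assms by metis

lemma presented_gen_closed:
  assumes "cring A" "Q \<subseteq> carrier (free_module A S)" "s \<in> S"
  shows "presented_gen A S Q s \<in> carrier (presented_module A S Q)"
  using presented_module_proj[OF assms(1,2)] free_gen_closed[OF assms(1,3)]
  by (metis imageI)

lemma presented_module_induct [consumes 3, case_names zero add gen]: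
  assumes A: "cring A" and Q: "Q \<subseteq> carrier (free_module A S)"
    and x: "x \<in> carrier (presented_module A S Q)"
    and zero: "P \<zero>\<^bsub>presented_module A S Q\<^esub>"
    and add: "\<And>x y. \<lbrakk>x \<in> carrier (presented_module A S Q); y \<in> carrier (presented_module A S Q);
      P x; P y\<rbrakk> \<Longrightarrow> P (x \<oplus>\<^bsub>presented_module A S Q\<^esub> y)"
    and gen: "\<And>a s. \<lbrakk>a \<in> carrier A; s \<in> S\<rbrakk> \<Longrightarrow>
      P (a \<odot>\<^bsub>presented_module A S Q\<^esub> presented_gen A S Q s)"
  shows "P x"
proof -
  obtain p where p: "linear_map A (free_module A S) (presented_module A S Q) p"
      "\<And>s. p (free_gen A s) = presented_gen A S Q s"
      "p ` carrier (free_module A S) = carrier (presented_module A S Q)"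
    using presented_module_proj[OF A Q] by metis
  have p0: "p \<zero>\<^bsub>free_module A S\<^esub> = \<zero>\<^bsub>presented_module A S Q\<^esub>"
    using free_module_module[OF A] presented_module_module[OF A Q] p(1) by (rule linear_map_zero)
  obtain f where f: "f \<in> carrier (free_module A S)" "x = p f" using p(3) x by auto
  have "P (p f)" using A f(1)
  proof (induction rule: free_module_induct)
    case zero
    show ?case unfolding p0 by (rule assms(4))
  next
    case (add f g)
    then show ?case
      using assms(5)[OF linear_mapD(1)[OF p(1) add(1)] linear_mapD(1)[OF p(1) add(2)]]
      by (simp only: linear_mapD(2)[OF p(1)])
  next
    case (gen a s)
    have "p (a \<odot>\<^bsub>free_module A S\<^esub> free_gen A s) =
        a \<odot>\<^bsub>presented_module A S Q\<^esub> presented_gen A S Q s"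
      using linear_mapD(3)[OF p(1) gen(1) free_gen_closed[OF A gen(2)]] p(2) by metis
    with assms(6)[OF gen] show ?case by metis
  qed
  then show ?thesis using f(2) by simp
qed

text \<open>A linear map that vanishes on the relations vanishes on the submodule they generate, because its
  kernel is a submodule.\<close>

lemma presented_module_lift:
  assumes F: "module A (free_module A S)" and M: "module A M"
    and Q: "Q \<subseteq> carrier (free_module A S)"
    and h: "linear_map A (free_module A S) M h" and zero: "\<And>q. q \<in> Q \<Longrightarrow> h q = \<zero>\<^bsub>M\<^esub>"
  obtains k where "linear_map A (presented_module A S Q) M k"
    and "\<And>s. s \<in> S \<Longrightarrow> k (presented_gen A S Q s) = h (free_gen A s)"
proof -
  interpret M: module A M by fact
  let ?F = "free_module A S"
  let ?N = "submodule_gen A ?F Q"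
  have N: "submodule ?N A ?F" using F Q by (rule submodule_gen_submodule)
  have "?N \<subseteq> {x \<in> carrier ?F. h x = \<zero>\<^bsub>M\<^esub>}"
    using kernel_submodule[OF F M h] zero Q by (intro submodule_gen_least) auto
  then obtain k where k: "linear_map A (quot_module ?F ?N) M k"
      "\<And>x. x \<in> carrier ?F \<Longrightarrow> k (?N +>\<^bsub>?F\<^esub> x) = h x"
    using quot_module_lift[OF F N M h] by blast
  show thesis
  proof (rule that)
    show "linear_map A (presented_module A S Q) M k"
      using k(1) by (simp add: presented_module_def)
    show "k (presented_gen A S Q s) = h (free_gen A s)" if "s \<in> S" for s
      using k(2)[OF free_gen_closed[OF M.R.is_cring that]] by (simp add: presented_gen_def)
  qed
qed


section \<open>Tensor products\<close>

lemma tensor_relations_closed: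
  assumes "module A M" "module A N"
  shows "tensor_relations A M N \<subseteq> carrier (free_module A (carrier M \<times> carrier N))"
proof -
  interpret M: module A M by fact
  interpret N: module A N by fact
  interpret F: module A "free_module A (carrier M \<times> carrier N)"
    using M.R.is_cring by (rule free_module_module)
  have "free_gen A (x, y) \<in> carrier (free_module A (carrier M \<times> carrier N))"
    if "x \<in> carrier M" "y \<in> carrier N" for x y
    using free_gen_closed[OF M.R.is_cring, of "(x, y)" "carrier M \<times> carrier N"] that by simp
  then show ?thesis
    unfolding tensor_relations_def Let_def by auto
qed

lemma tensor_module_module:
  assumes "module A M" "module A N"
  shows "module A (tensor_module A M N)"
  unfolding tensor_module_def
  using assms by (intro presented_module_module tensor_relations_closed) (simp add: module_def)

lemma tensor_closed:
  assumes "module A M" "module A N" "x \<in> carrier M" "y \<in> carrier N"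
  shows "tensor A M N x y \<in> carrier (tensor_module A M N)"
  unfolding tensor_module_def tensor_def
  using assms by (intro presented_gen_closed tensor_relations_closed) (simp_all add: module_def)

lemma tensor_bilinear:
  assumes M: "module A M" and N: "module A N"
  shows "\<lbrakk>x \<in> carrier M; x' \<in> carrier M; y \<in> carrier N\<rbrakk> \<Longrightarrow>
      tensor A M N (x \<oplus>\<^bsub>M\<^esub> x') y = tensor A M N x y \<oplus>\<^bsub>tensor_module A M N\<^esub> tensor A M N x' y"
    and "\<lbrakk>x \<in> carrier M; y \<in> carrier N; y' \<in> carrier N\<rbrakk> \<Longrightarrow>
      tensor A M N x (y \<oplus>\<^bsub>N\<^esub> y') = tensor A M N x y \<oplus>\<^bsub>tensor_module A M N\<^esub> tensor A M N x y'"
    and "\<lbrakk>a \<in> carrier A; x \<in> carrier M; y \<in> carrier N\<rbrakk> \<Longrightarrow>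
      tensor A M N (a \<odot>\<^bsub>M\<^esub> x) y = a \<odot>\<^bsub>tensor_module A M N\<^esub> tensor A M N x y"
    and "\<lbrakk>a \<in> carrier A; x \<in> carrier M; y \<in> carrier N\<rbrakk> \<Longrightarrow>
      tensor A M N x (a \<odot>\<^bsub>N\<^esub> y) = a \<odot>\<^bsub>tensor_module A M N\<^esub> tensor A M N x y"
proof -
  interpret M: module A M by fact
  interpret N: module A N by fact
  let ?S = "carrier M \<times> carrier N"
  let ?F = "free_module A ?S"
  let ?Q = "tensor_relations A M N"
  let ?T = "tensor_module A M N"
  let ?e = "free_gen A"
  note A = M.R.is_cring
  interpret F: module A ?F using A by (rule free_module_module)
  have Q: "?Q \<subseteq> carrier ?F" using M N by (rule tensor_relations_closed)
  obtain p where p: "linear_map A ?F ?T p" "\<And>s. p (?e s) = presented_gen A ?S ?Q s"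
      "\<And>q. q \<in> ?Q \<Longrightarrow> p q = \<zero>\<^bsub>?T\<^esub>"
    using presented_module_proj[OF A Q] unfolding tensor_module_def by metis
  have pe: "p (?e (x, y)) = tensor A M N x y" for x y
    using p(2) by (simp add: tensor_def)
  have e: "?e (x, y) \<in> carrier ?F" if "x \<in> carrier M" "y \<in> carrier N" for x y
    using free_gen_closed[OF A, of "(x, y)" ?S] that by simp
  have eq: "p l = p r" if "l \<in> carrier ?F" "r \<in> carrier ?F" "l \<ominus>\<^bsub>?F\<^esub> r \<in> ?Q" for l r
    using presented_module_eqI[OF A Q _ _ that] p unfolding tensor_module_def by metis
  show "tensor A M N (x \<oplus>\<^bsub>M\<^esub> x') y = tensor A M N x y \<oplus>\<^bsub>?T\<^esub> tensor A M N x' y"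
    if "x \<in> carrier M" "x' \<in> carrier M" "y \<in> carrier N"
  proof -
    have "?e (x \<oplus>\<^bsub>M\<^esub> x', y) \<ominus>\<^bsub>?F\<^esub> (?e (x, y) \<oplus>\<^bsub>?F\<^esub> ?e (x', y)) \<in> ?Q"
      using that unfolding tensor_relations_def Let_def by blast
    then have "p (?e (x \<oplus>\<^bsub>M\<^esub> x', y)) = p (?e (x, y) \<oplus>\<^bsub>?F\<^esub> ?e (x', y))"
      using that by (intro eq) (simp_all add: e)
    then show ?thesis using that by (simp add: linear_mapD(2)[OF p(1)] e pe)
  qed
  show "tensor A M N x (y \<oplus>\<^bsub>N\<^esub> y') = tensor A M N x y \<oplus>\<^bsub>?T\<^esub> tensor A M N x y'"
    if "x \<in> carrier M" "y \<in> carrier N" "y' \<in> carrier N"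
  proof -
    have "?e (x, y \<oplus>\<^bsub>N\<^esub> y') \<ominus>\<^bsub>?F\<^esub> (?e (x, y) \<oplus>\<^bsub>?F\<^esub> ?e (x, y')) \<in> ?Q"
      using that unfolding tensor_relations_def Let_def by blast
    then have "p (?e (x, y \<oplus>\<^bsub>N\<^esub> y')) = p (?e (x, y) \<oplus>\<^bsub>?F\<^esub> ?e (x, y'))"
      using that by (intro eq) (simp_all add: e)
    then show ?thesis using that by (simp add: linear_mapD(2)[OF p(1)] e pe)
  qed
  show "tensor A M N (a \<odot>\<^bsub>M\<^esub> x) y = a \<odot>\<^bsub>?T\<^esub> tensor A M N x y"
    if "a \<in> carrier A" "x \<in> carrier M" "y \<in> carrier N"
  proof -
    have "?e (a \<odot>\<^bsub>M\<^esub> x, y) \<ominus>\<^bsub>?F\<^esub> a \<odot>\<^bsub>?F\<^esub> ?e (x, y) \<in> ?Q"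
      using that unfolding tensor_relations_def Let_def by blast
    then have "p (?e (a \<odot>\<^bsub>M\<^esub> x, y)) = p (a \<odot>\<^bsub>?F\<^esub> ?e (x, y))"
      using that by (intro eq) (simp_all add: e)
    then show ?thesis using that by (simp add: linear_mapD(3)[OF p(1)] e pe)
  qed
  show "tensor A M N x (a \<odot>\<^bsub>N\<^esub> y) = a \<odot>\<^bsub>?T\<^esub> tensor A M N x y"
    if "a \<in> carrier A" "x \<in> carrier M" "y \<in> carrier N"
  proof -
    have "?e (x, a \<odot>\<^bsub>N\<^esub> y) \<ominus>\<^bsub>?F\<^esub> a \<odot>\<^bsub>?F\<^esub> ?e (x, y) \<in> ?Q"
      using that unfolding tensor_relations_def Let_def by blast
    then have "p (?e (x, a \<odot>\<^bsub>N\<^esub> y)) = p (a \<odot>\<^bsub>?F\<^esub> ?e (x, y))"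
      using that by (intro eq) (simp_all add: e)
    then show ?thesis using that by (simp add: linear_mapD(3)[OF p(1)] e pe)
  qed
qed

text \<open>Multiples of a pure tensor are pure tensors, so these generate additively.\<close>

lemma tensor_module_induct [consumes 3, case_names zero add tensor]:
  assumes M: "module A M" and N: "module A N" and t: "t \<in> carrier (tensor_module A M N)"
    and zero: "P \<zero>\<^bsub>tensor_module A M N\<^esub>"
    and add: "\<And>s t. \<lbrakk>s \<in> carrier (tensor_module A M N); t \<in> carrier (tensor_module A M N);
      P s; P t\<rbrakk> \<Longrightarrow> P (s \<oplus>\<^bsub>tensor_module A M N\<^esub> t)"
    and tensor: "\<And>x y. \<lbrakk>x \<in> carrier M; y \<in> carrier N\<rbrakk> \<Longrightarrow> P (tensor A M N x y)"
  shows "P t"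
proof -
  interpret M: module A M by fact
  have gen: "P (a \<odot>\<^bsub>tensor_module A M N\<^esub> presented_gen A (carrier M \<times> carrier N) (tensor_relations A M N) s)"
    if "a \<in> carrier A" "s \<in> carrier M \<times> carrier N" for a s
  proof (cases s)
    case (Pair x y)
    with that have "P (tensor A M N (a \<odot>\<^bsub>M\<^esub> x) y)" by (intro tensor) auto
    then show ?thesis
      using that Pair tensor_bilinear(3)[OF M N, of a x y] by (simp add: tensor_def)
  qed
  show ?thesis
    using M.R.is_cring tensor_relations_closed[OF M N] t[unfolded tensor_module_def]
    by (induction rule: presented_module_induct) (use zero add gen in \<open>auto simp: tensor_module_def\<close>)
qed

lemma tensor_module_lift:
  assumes M: "module A M" and N: "module A N" and P: "module A P"
    and left: "\<And>y. y \<in> carrier N \<Longrightarrow> linear_map A M P (\<lambda>x. b x y)"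
    and right: "\<And>x. x \<in> carrier M \<Longrightarrow> linear_map A N P (b x)"
  obtains k where "linear_map A (tensor_module A M N) P k"
    and "\<And>x y. \<lbrakk>x \<in> carrier M; y \<in> carrier N\<rbrakk> \<Longrightarrow> k (tensor A M N x y) = b x y"
proof -
  interpret M: module A M by fact
  interpret N: module A N by fact
  let ?S = "carrier M \<times> carrier N"
  let ?F = "free_module A ?S"
  let ?Q = "tensor_relations A M N"
  let ?e = "free_gen A"
  note A = M.R.is_cring
  have F: "module A ?F" using A by (rule free_module_module)
  interpret F: module A ?F by fact
  have Q: "?Q \<subseteq> carrier ?F" using M N by (rule tensor_relations_closed)
  have g: "case_prod b \<in> ?S \<rightarrow> carrier P"
    using left linear_mapD(1) by fastforce
  obtain h where h: "linear_map A ?F P h"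
    and he: "\<And>s. s \<in> ?S \<Longrightarrow> h (?e s) = case_prod b s"
    using free_module_lift[OF P g] by blast
  have e: "?e (x, y) \<in> carrier ?F" if "x \<in> carrier M" "y \<in> carrier N" for x y
    using free_gen_closed[OF A, of "(x, y)" ?S] that by simp
  have rel: "h q = \<zero>\<^bsub>P\<^esub>" if q: "q \<in> ?Q" for q
    using q unfolding tensor_relations_def Let_def
    by (auto simp: linear_map_minus_eq_zero[OF F P h] linear_mapD(2,3)[OF h] e he
        linear_mapD(2,3)[OF left] linear_mapD(2,3)[OF right])
  obtain k where k: "linear_map A (tensor_module A M N) P k"
      "\<And>s. s \<in> ?S \<Longrightarrow> k (presented_gen A ?S ?Q s) = h (?e s)"
    using presented_module_lift[OF F P Q h rel] unfolding tensor_module_def by blast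
  show thesis
    using that[OF k(1)] k(2) he by (simp add: tensor_def)
qed


section \<open>Kaehler differentials\<close>

context algebra
begin

lemma kahler_relations_closed: "kahler_relations R M \<subseteq> carrier (free_module M (carrier M))"
proof -
  interpret F: module M "free_module M (carrier M)"
    using M_cring by (rule free_module_module)
  note e = free_gen_closed[OF M_cring]
  show ?thesis
    unfolding kahler_relations_def Let_def by (auto simp: e)
qed

lemma kahler_module: "module M (kahler R M)"
  unfolding kahler_def using M_cring kahler_relations_closed by (rule presented_module_module)

lemma kahler_d_closed: "u \<in> carrier M \<Longrightarrow> kahler_d R M u \<in> carrier (kahler R M)"
  unfolding kahler_def kahler_d_def using M_cring kahler_relations_closed by (rule presented_gen_closed)

lemma kahler_d_derivation:
  shows "\<lbrakk>u \<in> carrier M; v \<in> carrier M\<rbrakk> \<Longrightarrow>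
      kahler_d R M (u \<oplus>\<^bsub>M\<^esub> v) = kahler_d R M u \<oplus>\<^bsub>kahler R M\<^esub> kahler_d R M v"
    and "\<lbrakk>r \<in> carrier R; u \<in> carrier M\<rbrakk> \<Longrightarrow>
      kahler_d R M (r \<odot>\<^bsub>M\<^esub> u) = (r \<odot>\<^bsub>M\<^esub> \<one>\<^bsub>M\<^esub>) \<odot>\<^bsub>kahler R M\<^esub> kahler_d R M u"
    and "\<lbrakk>u \<in> carrier M; v \<in> carrier M\<rbrakk> \<Longrightarrow>
      kahler_d R M (u \<otimes>\<^bsub>M\<^esub> v) =
        u \<odot>\<^bsub>kahler R M\<^esub> kahler_d R M v \<oplus>\<^bsub>kahler R M\<^esub> v \<odot>\<^bsub>kahler R M\<^esub> kahler_d R M u"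
proof -
  let ?F = "free_module M (carrier M)"
  let ?Q = "kahler_relations R M"
  let ?D = "kahler R M"
  let ?d = "kahler_d R M"
  let ?e = "free_gen M"
  interpret F: module M ?F using M_cring by (rule free_module_module)
  note Q = kahler_relations_closed
  obtain p where p: "linear_map M ?F ?D p" "\<And>s. p (?e s) = ?d s"
      "\<And>q. q \<in> ?Q \<Longrightarrow> p q = \<zero>\<^bsub>?D\<^esub>"
    using presented_module_proj[OF M_cring Q] unfolding kahler_def kahler_d_def by metis
  note e = free_gen_closed[OF M_cring]
  have eq: "p l = p r" if "l \<in> carrier ?F" "r \<in> carrier ?F" "l \<ominus>\<^bsub>?F\<^esub> r \<in> ?Q" for l r
    using presented_module_eqI[OF M_cring Q _ _ that] p unfolding kahler_def by metis
  show "?d (u \<oplus>\<^bsub>M\<^esub> v) = ?d u \<oplus>\<^bsub>?D\<^esub> ?d v" if "u \<in> carrier M" "v \<in> carrier M" for u v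
  proof -
    have "?e (u \<oplus>\<^bsub>M\<^esub> v) \<ominus>\<^bsub>?F\<^esub> (?e u \<oplus>\<^bsub>?F\<^esub> ?e v) \<in> ?Q"
      using that unfolding kahler_relations_def Let_def by blast
    then have "p (?e (u \<oplus>\<^bsub>M\<^esub> v)) = p (?e u \<oplus>\<^bsub>?F\<^esub> ?e v)"
      using that by (intro eq) (simp_all add: e)
    then show ?thesis using that by (simp add: linear_mapD(2)[OF p(1)] e p(2))
  qed
  show "?d (r \<odot>\<^bsub>M\<^esub> u) = (r \<odot>\<^bsub>M\<^esub> \<one>\<^bsub>M\<^esub>) \<odot>\<^bsub>?D\<^esub> ?d u" if "r \<in> carrier R" "u \<in> carrier M" for r u
  proof -
    have "?e (r \<odot>\<^bsub>M\<^esub> u) \<ominus>\<^bsub>?F\<^esub> (r \<odot>\<^bsub>M\<^esub> \<one>\<^bsub>M\<^esub>) \<odot>\<^bsub>?F\<^esub> ?e u \<in> ?Q"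
      using that unfolding kahler_relations_def Let_def by blast
    then have "p (?e (r \<odot>\<^bsub>M\<^esub> u)) = p ((r \<odot>\<^bsub>M\<^esub> \<one>\<^bsub>M\<^esub>) \<odot>\<^bsub>?F\<^esub> ?e u)"
      using that by (intro eq) (simp_all add: e)
    then show ?thesis using that by (simp add: linear_mapD(3)[OF p(1)] e p(2))
  qed
  show "?d (u \<otimes>\<^bsub>M\<^esub> v) = u \<odot>\<^bsub>?D\<^esub> ?d v \<oplus>\<^bsub>?D\<^esub> v \<odot>\<^bsub>?D\<^esub> ?d u"
    if "u \<in> carrier M" "v \<in> carrier M" for u v
  proof -
    have "?e (u \<otimes>\<^bsub>M\<^esub> v) \<ominus>\<^bsub>?F\<^esub> (u \<odot>\<^bsub>?F\<^esub> ?e v \<oplus>\<^bsub>?F\<^esub> v \<odot>\<^bsub>?F\<^esub> ?e u) \<in> ?Q"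
      using that unfolding kahler_relations_def Let_def by blast
    then have "p (?e (u \<otimes>\<^bsub>M\<^esub> v)) = p (u \<odot>\<^bsub>?F\<^esub> ?e v \<oplus>\<^bsub>?F\<^esub> v \<odot>\<^bsub>?F\<^esub> ?e u)"
      using that by (intro eq) (simp_all add: e)
    then show ?thesis using that by (simp add: linear_mapD(2,3)[OF p(1)] e p(2))
  qed
qed

lemma kahler_induct [consumes 1, case_names zero add gen]:
  assumes x: "x \<in> carrier (kahler R M)"
    and zero: "P \<zero>\<^bsub>kahler R M\<^esub>"
    and add: "\<And>x y. \<lbrakk>x \<in> carrier (kahler R M); y \<in> carrier (kahler R M); P x; P y\<rbrakk> \<Longrightarrow>
      P (x \<oplus>\<^bsub>kahler R M\<^esub> y)"
    and gen: "\<And>a u. \<lbrakk>a \<in> carrier M; u \<in> carrier M\<rbrakk> \<Longrightarrow> P (a \<odot>\<^bsub>kahler R M\<^esub> kahler_d R M u)"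
  shows "P x"
  using M_cring kahler_relations_closed x[unfolded kahler_def]
  by (induction rule: presented_module_induct)
    (use zero add gen in \<open>auto simp: kahler_def kahler_d_def\<close>)

text \<open>The three conditions on \<open>\<delta>\<close> match the three families of relations between the symbols \<open>du\<close>, so the
  linear extension of \<open>\<delta>\<close> to the free module vanishes on them.\<close>

lemma kahler_lift:
  assumes N: "module M N" and closed: "\<And>u. u \<in> carrier M \<Longrightarrow> \<delta> u \<in> carrier N"
    and add: "\<And>u v. \<lbrakk>u \<in> carrier M; v \<in> carrier M\<rbrakk> \<Longrightarrow> \<delta> (u \<oplus>\<^bsub>M\<^esub> v) = \<delta> u \<oplus>\<^bsub>N\<^esub> \<delta> v"
    and smult: "\<And>r u. \<lbrakk>r \<in> carrier R; u \<in> carrier M\<rbrakk> \<Longrightarrow>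
      \<delta> (r \<odot>\<^bsub>M\<^esub> u) = (r \<odot>\<^bsub>M\<^esub> \<one>\<^bsub>M\<^esub>) \<odot>\<^bsub>N\<^esub> \<delta> u"
    and mult: "\<And>u v. \<lbrakk>u \<in> carrier M; v \<in> carrier M\<rbrakk> \<Longrightarrow>
      \<delta> (u \<otimes>\<^bsub>M\<^esub> v) = u \<odot>\<^bsub>N\<^esub> \<delta> v \<oplus>\<^bsub>N\<^esub> v \<odot>\<^bsub>N\<^esub> \<delta> u"
  obtains k where "linear_map M (kahler R M) N k"
    and "\<And>u. u \<in> carrier M \<Longrightarrow> k (kahler_d R M u) = \<delta> u"
proof -
  let ?F = "free_module M (carrier M)"
  let ?Q = "kahler_relations R M"
  let ?e = "free_gen M"
  have F: "module M ?F" using M_cring by (rule free_module_module)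
  interpret F: module M ?F by fact
  note e = free_gen_closed[OF M_cring]
  have "\<delta> \<in> carrier M \<rightarrow> carrier N" using closed by blast
  then obtain h where h: "linear_map M ?F N h"
    and he: "\<And>u. u \<in> carrier M \<Longrightarrow> h (?e u) = \<delta> u"
    using free_module_lift[OF N] by blast
  have rel: "h q = \<zero>\<^bsub>N\<^esub>" if q: "q \<in> ?Q" for q
    using q unfolding kahler_relations_def Let_def
    by (auto simp: linear_map_minus_eq_zero[OF F N h] linear_mapD(2,3)[OF h] e he add smult mult)
  obtain k where "linear_map M (kahler R M) N k"
      "\<And>u. u \<in> carrier M \<Longrightarrow> k (kahler_d R M u) = h (?e u)"
    using presented_module_lift[OF F N kahler_relations_closed h rel]
    unfolding kahler_def kahler_d_def by blast
  then show thesis using that he by simp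
qed

text \<open>Assuming linearity instead of additivity would exclude the bracket, which is additive in each
  argument but not \<open>M\<close>-linear.\<close>

lemma kahler_additive_eqI:
  assumes N: "abelian_group N" and x: "x \<in> carrier (kahler R M)"
    and fg: "\<And>x. x \<in> carrier (kahler R M) \<Longrightarrow> f x \<in> carrier N"
      "\<And>x. x \<in> carrier (kahler R M) \<Longrightarrow> g x \<in> carrier N"
    and f: "\<And>x y. \<lbrakk>x \<in> carrier (kahler R M); y \<in> carrier (kahler R M)\<rbrakk> \<Longrightarrow>
      f (x \<oplus>\<^bsub>kahler R M\<^esub> y) = f x \<oplus>\<^bsub>N\<^esub> f y"
    and g: "\<And>x y. \<lbrakk>x \<in> carrier (kahler R M); y \<in> carrier (kahler R M)\<rbrakk> \<Longrightarrow>
      g (x \<oplus>\<^bsub>kahler R M\<^esub> y) = g x \<oplus>\<^bsub>N\<^esub> g y"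
    and gen: "\<And>a u. \<lbrakk>a \<in> carrier M; u \<in> carrier M\<rbrakk> \<Longrightarrow>
      f (a \<odot>\<^bsub>kahler R M\<^esub> kahler_d R M u) = g (a \<odot>\<^bsub>kahler R M\<^esub> kahler_d R M u)"
  shows "f x = g x"
proof -
  have D: "abelian_group (kahler R M)" using kahler_module by (simp add: module_def)
  show ?thesis
    using x
  proof (induction rule: kahler_induct)
    case zero
    show ?case
      using additive_zero[OF D N fg(1) f] additive_zero[OF D N fg(2) g] by simp
  qed (simp_all add: f g gen)
qed

end


section \<open>Operators on differentials that cover a derivation\<close>

context algebra
begin

definition derivation :: "('c \<Rightarrow> 'c) \<Rightarrow> bool" where
  "derivation X \<longleftrightarrow> X \<in> carrier M \<rightarrow> carrier M \<and>
     (\<forall>u\<in>carrier M. \<forall>v\<in>carrier M. X (u \<oplus>\<^bsub>M\<^esub> v) = X u \<oplus>\<^bsub>M\<^esub> X v) \<and>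
     (\<forall>r\<in>carrier R. \<forall>u\<in>carrier M. X (r \<odot>\<^bsub>M\<^esub> u) = r \<odot>\<^bsub>M\<^esub> X u) \<and>
     (\<forall>u\<in>carrier M. \<forall>v\<in>carrier M. X (u \<otimes>\<^bsub>M\<^esub> v) = u \<otimes>\<^bsub>M\<^esub> X v \<oplus>\<^bsub>M\<^esub> v \<otimes>\<^bsub>M\<^esub> X u)"

lemma derivationD:
  assumes "derivation X"
  shows "u \<in> carrier M \<Longrightarrow> X u \<in> carrier M"
    and "\<lbrakk>u \<in> carrier M; v \<in> carrier M\<rbrakk> \<Longrightarrow> X (u \<oplus>\<^bsub>M\<^esub> v) = X u \<oplus>\<^bsub>M\<^esub> X v"
    and "\<lbrakk>r \<in> carrier R; u \<in> carrier M\<rbrakk> \<Longrightarrow> X (r \<odot>\<^bsub>M\<^esub> u) = r \<odot>\<^bsub>M\<^esub> X u"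
    and "\<lbrakk>u \<in> carrier M; v \<in> carrier M\<rbrakk> \<Longrightarrow>
      X (u \<otimes>\<^bsub>M\<^esub> v) = u \<otimes>\<^bsub>M\<^esub> X v \<oplus>\<^bsub>M\<^esub> v \<otimes>\<^bsub>M\<^esub> X u"
  using assms by (auto simp: derivation_def)

lemma derivation_unit_smult:
  assumes X: "derivation X" and r: "r \<in> carrier R"
  shows "X (r \<odot>\<^bsub>M\<^esub> \<one>\<^bsub>M\<^esub>) = \<zero>\<^bsub>M\<^esub>"
proof -
  have "X \<one>\<^bsub>M\<^esub> = X \<one>\<^bsub>M\<^esub> \<oplus>\<^bsub>M\<^esub> X \<one>\<^bsub>M\<^esub>"
    using derivationD(4)[OF X one_closed one_closed] derivationD(1)[OF X one_closed] by simp
  then have "X \<one>\<^bsub>M\<^esub> = \<zero>\<^bsub>M\<^esub>"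
    using derivationD(1)[OF X one_closed] by (metis add.l_cancel_one one_closed)
  then show ?thesis using derivationD(3)[OF X r one_closed] r by simp
qed

lemma unit_smult: "\<lbrakk>r \<in> carrier R; u \<in> carrier M\<rbrakk> \<Longrightarrow> (r \<odot>\<^bsub>M\<^esub> \<one>\<^bsub>M\<^esub>) \<otimes>\<^bsub>M\<^esub> u = r \<odot>\<^bsub>M\<^esub> u"
  by (simp add: smult_assoc2)

lemma unit_smult': "\<lbrakk>r \<in> carrier R; u \<in> carrier M\<rbrakk> \<Longrightarrow> u \<otimes>\<^bsub>M\<^esub> (r \<odot>\<^bsub>M\<^esub> \<one>\<^bsub>M\<^esub>) = r \<odot>\<^bsub>M\<^esub> u"
  using unit_smult m_comm[of u "r \<odot>\<^bsub>M\<^esub> \<one>\<^bsub>M\<^esub>"] by simp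

text \<open>An additive \<open>l\<close> with \<open>l(a x) = a l(x) + X(a) x\<close> corresponds to an \<open>M\<close>-linear section \<open>x \<mapsto> (x, l x)\<close> of the
  first projection \<open>T \<rightarrow> D\<close>, where \<open>T = D \<times> D\<close> is the \<open>M\<close>-module with \<open>a (x, y) = (a x, a y + X(a) x)\<close>; that
  this is associative is the product rule for \<open>X\<close>. The assumptions on \<open>\<delta>\<close> say that
  \<open>u \<mapsto> (du, \<delta> u)\<close> is a derivation into \<open>T\<close>, so the universal property applies.\<close>

lemma kahler_twisted_lift:
  assumes X: "derivation X" and closed: "\<And>u. u \<in> carrier M \<Longrightarrow> \<delta> u \<in> carrier (kahler R M)"
    and add: "\<And>u v. \<lbrakk>u \<in> carrier M; v \<in> carrier M\<rbrakk> \<Longrightarrow> \<delta> (u \<oplus>\<^bsub>M\<^esub> v) = \<delta> u \<oplus>\<^bsub>kahler R M\<^esub> \<delta> v"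
    and smult: "\<And>r u. \<lbrakk>r \<in> carrier R; u \<in> carrier M\<rbrakk> \<Longrightarrow>
      \<delta> (r \<odot>\<^bsub>M\<^esub> u) = (r \<odot>\<^bsub>M\<^esub> \<one>\<^bsub>M\<^esub>) \<odot>\<^bsub>kahler R M\<^esub> \<delta> u"
    and mult: "\<And>u v. \<lbrakk>u \<in> carrier M; v \<in> carrier M\<rbrakk> \<Longrightarrow> \<delta> (u \<otimes>\<^bsub>M\<^esub> v) =
      (u \<odot>\<^bsub>kahler R M\<^esub> \<delta> v \<oplus>\<^bsub>kahler R M\<^esub> X u \<odot>\<^bsub>kahler R M\<^esub> kahler_d R M v) \<oplus>\<^bsub>kahler R M\<^esub>
      (v \<odot>\<^bsub>kahler R M\<^esub> \<delta> u \<oplus>\<^bsub>kahler R M\<^esub> X v \<odot>\<^bsub>kahler R M\<^esub> kahler_d R M u)"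
  shows "\<exists>l. l \<in> carrier (kahler R M) \<rightarrow> carrier (kahler R M) \<and>
    (\<forall>x\<in>carrier (kahler R M). \<forall>y\<in>carrier (kahler R M).
      l (x \<oplus>\<^bsub>kahler R M\<^esub> y) = l x \<oplus>\<^bsub>kahler R M\<^esub> l y) \<and>
    (\<forall>a\<in>carrier M. \<forall>x\<in>carrier (kahler R M).
      l (a \<odot>\<^bsub>kahler R M\<^esub> x) = a \<odot>\<^bsub>kahler R M\<^esub> l x \<oplus>\<^bsub>kahler R M\<^esub> X a \<odot>\<^bsub>kahler R M\<^esub> x) \<and>
    (\<forall>u\<in>carrier M. l (kahler_d R M u) = \<delta> u)"
proof -
  let ?D = "kahler R M"
  let ?d = "kahler_d R M"
  interpret D: module M ?D by (rule kahler_module)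
  note XD = derivationD[OF X]
  define T :: "('c, ('c \<Rightarrow> 'c) set \<times> ('c \<Rightarrow> 'c) set) module" where
    "T = \<lparr>carrier = carrier ?D \<times> carrier ?D, mult = undefined, one = undefined,
      zero = (\<zero>\<^bsub>?D\<^esub>, \<zero>\<^bsub>?D\<^esub>), add = (\<lambda>p q. (fst p \<oplus>\<^bsub>?D\<^esub> fst q, snd p \<oplus>\<^bsub>?D\<^esub> snd q)),
      smult = (\<lambda>a p. (a \<odot>\<^bsub>?D\<^esub> fst p, a \<odot>\<^bsub>?D\<^esub> snd p \<oplus>\<^bsub>?D\<^esub> X a \<odot>\<^bsub>?D\<^esub> fst p))\<rparr>"
  have T_simps: "carrier T = carrier ?D \<times> carrier ?D" "\<zero>\<^bsub>T\<^esub> = (\<zero>\<^bsub>?D\<^esub>, \<zero>\<^bsub>?D\<^esub>)"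
    "p \<oplus>\<^bsub>T\<^esub> q = (fst p \<oplus>\<^bsub>?D\<^esub> fst q, snd p \<oplus>\<^bsub>?D\<^esub> snd q)"
    "a \<odot>\<^bsub>T\<^esub> p = (a \<odot>\<^bsub>?D\<^esub> fst p, a \<odot>\<^bsub>?D\<^esub> snd p \<oplus>\<^bsub>?D\<^esub> X a \<odot>\<^bsub>?D\<^esub> fst p)" for p q a
    by (simp_all add: T_def)
  have X1: "X \<one>\<^bsub>M\<^esub> = \<zero>\<^bsub>M\<^esub>"
    using derivation_unit_smult[OF X, of "\<one>\<^bsub>R\<^esub>"] by simp
  have T: "module M T"
  proof (rule moduleI[OF M_cring])
    show "abelian_group T"
    proof (rule abelian_groupI)
      fix p assume "p \<in> carrier T"
      then show "\<exists>q\<in>carrier T. q \<oplus>\<^bsub>T\<^esub> p = \<zero>\<^bsub>T\<^esub>"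
        by (intro bexI[of _ "(\<ominus>\<^bsub>?D\<^esub> fst p, \<ominus>\<^bsub>?D\<^esub> snd p)"]) (auto simp: T_simps D.M.l_neg)
    qed (auto simp: T_simps D.M.a_ac)
  qed (simp_all add: T_simps XD X1 D.smult_l_distr D.smult_r_distr D.M.a_ac m_comm mem_Times_iff
      flip: D.smult_assoc1)
  obtain k where k: "linear_map M ?D T k" and kd: "\<And>u. u \<in> carrier M \<Longrightarrow> k (?d u) = (?d u, \<delta> u)"
  proof (rule kahler_lift[OF T, of "\<lambda>u. (?d u, \<delta> u)"])
    show "(?d u, \<delta> u) \<in> carrier T" if "u \<in> carrier M" for u
      using that by (simp add: T_simps closed kahler_d_closed)
    show "(?d (u \<oplus>\<^bsub>M\<^esub> v), \<delta> (u \<oplus>\<^bsub>M\<^esub> v)) = (?d u, \<delta> u) \<oplus>\<^bsub>T\<^esub> (?d v, \<delta> v)"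
      if "u \<in> carrier M" "v \<in> carrier M" for u v
      using that by (simp add: T_simps add kahler_d_derivation)
    show "(?d (r \<odot>\<^bsub>M\<^esub> u), \<delta> (r \<odot>\<^bsub>M\<^esub> u)) = (r \<odot>\<^bsub>M\<^esub> \<one>\<^bsub>M\<^esub>) \<odot>\<^bsub>T\<^esub> (?d u, \<delta> u)"
      if "r \<in> carrier R" "u \<in> carrier M" for r u
      using that by (simp add: T_simps smult kahler_d_derivation derivation_unit_smult[OF X]
          closed kahler_d_closed)
    show "(?d (u \<otimes>\<^bsub>M\<^esub> v), \<delta> (u \<otimes>\<^bsub>M\<^esub> v)) =
        u \<odot>\<^bsub>T\<^esub> (?d v, \<delta> v) \<oplus>\<^bsub>T\<^esub> v \<odot>\<^bsub>T\<^esub> (?d u, \<delta> u)"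
      if "u \<in> carrier M" "v \<in> carrier M" for u v
      using that by (simp add: T_simps mult kahler_d_derivation)
  qed blast
  have kT: "fst (k x) \<in> carrier ?D" "snd (k x) \<in> carrier ?D" if "x \<in> carrier ?D" for x
    using linear_mapD(1)[OF k that] by (auto simp: T_simps)
  \<comment> \<open>The first component is linear and fixes every \<open>du\<close>.\<close>
  have fst_k: "fst (k x) = x" if "x \<in> carrier ?D" for x
    using D.M.abelian_group_axioms that
    by (rule kahler_additive_eqI)
      (simp_all add: kT linear_mapD(2,3)[OF k] kd kahler_d_closed T_simps)
  show ?thesis
    by (rule exI[of _ "snd \<circ> k"]) (simp add: linear_mapD(2,3)[OF k] T_simps kT fst_k kd)
qed

end


section \<open>The Lie algebra of differentials\<close>

lemma PiE_ext2:
  assumes f: "f \<in> I \<rightarrow>\<^sub>E J \<rightarrow>\<^sub>E K" and g: "g \<in> I \<rightarrow>\<^sub>E J \<rightarrow>\<^sub>E K"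
    and eq: "\<And>x y. \<lbrakk>x \<in> I; y \<in> J\<rbrakk> \<Longrightarrow> f x y = g x y"
  shows "f = g"
proof (rule PiE_ext[OF f g])
  fix x assume x: "x \<in> I"
  show "f x = g x"
    by (rule PiE_ext[OF PiE_mem[OF f x] PiE_mem[OF g x]]) (rule eq[OF x])
qed

context poisson_algebra
begin

abbreviation D where "D \<equiv> kahler R A"
abbreviation d where "d \<equiv> kahler_d R A"

interpretation D: module A "kahler R A" by (rule kahler_module)

lemmas d_closed = kahler_d_closed

lemma br_skew:
  assumes "u \<in> carrier A" "v \<in> carrier A"
  shows "br v u = \<ominus>\<^bsub>A\<^esub> br u v"
proof -
  have "br (u \<oplus>\<^bsub>A\<^esub> v) (u \<oplus>\<^bsub>A\<^esub> v) = br u v \<oplus>\<^bsub>A\<^esub> br v u"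
    using assms a_comm[of "br u v" "br v u"]
    by (simp add: br_add_left br_add_right br_self[of u] br_self[of v] br_closed)
  then have "br v u \<oplus>\<^bsub>A\<^esub> br u v = \<zero>\<^bsub>A\<^esub>"
    using assms br_self[of "u \<oplus>\<^bsub>A\<^esub> v"] a_comm[of "br u v" "br v u"] by (simp add: br_closed)
  then show ?thesis using assms by (simp add: br_closed minus_equality)
qed

lemma derivation_br_left:
  assumes "c \<in> carrier A"
  shows "derivation (\<lambda>u. br u c)"
  using assms
  by (auto simp: derivation_def br_closed br_add_left br_smult_left br_leibniz m_comm)

lemma derivation_br_right:
  assumes "c \<in> carrier A"
  shows "derivation (br c)"
proof -
  have "br c (u \<otimes>\<^bsub>A\<^esub> v) = u \<otimes>\<^bsub>A\<^esub> br c v \<oplus>\<^bsub>A\<^esub> v \<otimes>\<^bsub>A\<^esub> br c u"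
    if "u \<in> carrier A" "v \<in> carrier A" for u v
  proof -
    have "br c (u \<otimes>\<^bsub>A\<^esub> v) = \<ominus>\<^bsub>A\<^esub> (u \<otimes>\<^bsub>A\<^esub> br v c \<oplus>\<^bsub>A\<^esub> v \<otimes>\<^bsub>A\<^esub> br u c)"
      using that assms br_skew[of "u \<otimes>\<^bsub>A\<^esub> v" c] derivationD(4)[OF derivation_br_left[OF assms]]
      by simp
    also have "\<dots> = u \<otimes>\<^bsub>A\<^esub> br c v \<oplus>\<^bsub>A\<^esub> v \<otimes>\<^bsub>A\<^esub> br c u"
      using that assms br_skew[of v c] br_skew[of u c]
      by (simp add: br_closed minus_add r_minus)
    finally show ?thesis .
  qed
  then show ?thesis
    using assms by (auto simp: derivation_def br_closed br_add_right br_smult_right)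
qed

text \<open>For each \<open>c\<close> the derivation \<open>u \<mapsto> {u, c}\<close> extends linearly to \<open>D\<close>.\<close>

lemma kahler_action_unique:
  "\<exists>!\<rho>. \<rho> \<in> carrier D \<rightarrow>\<^sub>E carrier A \<rightarrow>\<^sub>E carrier A \<and>
      (\<forall>x\<in>carrier D. \<forall>y\<in>carrier D. \<forall>c\<in>carrier A. \<rho> (x \<oplus>\<^bsub>D\<^esub> y) c = \<rho> x c \<oplus>\<^bsub>A\<^esub> \<rho> y c) \<and>
      (\<forall>a\<in>carrier A. \<forall>x\<in>carrier D. \<forall>c\<in>carrier A. \<rho> (a \<odot>\<^bsub>D\<^esub> x) c = a \<otimes>\<^bsub>A\<^esub> \<rho> x c) \<and>
      (\<forall>a\<in>carrier A. \<forall>u\<in>carrier A. \<forall>c\<in>carrier A. \<rho> (a \<odot>\<^bsub>D\<^esub> d u) c = a \<otimes>\<^bsub>A\<^esub> br u c)"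
  (is "\<exists>!\<rho>. ?P \<rho>")
proof (rule ex_ex1I)
  have "\<forall>c\<in>carrier A. \<exists>k. linear_map A D (regular_module A) k \<and> (\<forall>u\<in>carrier A. k (d u) = br u c)"
  proof
    fix c assume c: "c \<in> carrier A"
    note der = derivationD[OF derivation_br_left[OF c]]
    obtain k where "linear_map A D (regular_module A) k" "\<And>u. u \<in> carrier A \<Longrightarrow> k (d u) = br u c"
      by (rule kahler_lift[OF regular_module_module[OF is_cring], of "\<lambda>u. br u c"])
        (simp_all add: der c br_closed unit_smult)
    then show "\<exists>k. linear_map A D (regular_module A) k \<and> (\<forall>u\<in>carrier A. k (d u) = br u c)"
      by blast
  qed
  then obtain k where k: "\<And>c. c \<in> carrier A \<Longrightarrow> linear_map A D (regular_module A) (k c)"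
    "\<And>c u. c \<in> carrier A \<Longrightarrow> u \<in> carrier A \<Longrightarrow> k c (d u) = br u c"
    by metis
  have "?P (\<lambda>x\<in>carrier D. \<lambda>c\<in>carrier A. k c x)"
    using linear_mapD[OF k(1)] k(2) by (auto simp: d_closed)
  then show "\<exists>\<rho>. ?P \<rho>" by (rule exI[where P = ?P])
next
  fix \<rho> \<sigma> assume P: "?P \<rho>" "?P \<sigma>"
  then have ext: "\<rho> \<in> carrier D \<rightarrow>\<^sub>E carrier A \<rightarrow>\<^sub>E carrier A" "\<sigma> \<in> carrier D \<rightarrow>\<^sub>E carrier A \<rightarrow>\<^sub>E carrier A"
    by simp_all
  have "\<rho> x c = \<sigma> x c" if x: "x \<in> carrier D" and c: "c \<in> carrier A" for x c
    using abelian_group_axioms x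
    by (rule kahler_additive_eqI) (use P c in \<open>auto simp: PiE_iff\<close>)
  then show "\<rho> = \<sigma>"
    by (rule PiE_ext2[OF ext])
qed

abbreviation act where "act \<equiv> kahler_action R A br"

lemma kahler_action:
  shows act_closed: "\<lbrakk>x \<in> carrier D; c \<in> carrier A\<rbrakk> \<Longrightarrow> act x c \<in> carrier A"
    and act_add: "\<lbrakk>x \<in> carrier D; y \<in> carrier D; c \<in> carrier A\<rbrakk> \<Longrightarrow>
      act (x \<oplus>\<^bsub>D\<^esub> y) c = act x c \<oplus>\<^bsub>A\<^esub> act y c"
    and act_smult: "\<lbrakk>a \<in> carrier A; x \<in> carrier D; c \<in> carrier A\<rbrakk> \<Longrightarrow>
      act (a \<odot>\<^bsub>D\<^esub> x) c = a \<otimes>\<^bsub>A\<^esub> act x c"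
    and act_gen: "\<lbrakk>a \<in> carrier A; u \<in> carrier A; c \<in> carrier A\<rbrakk> \<Longrightarrow>
      act (a \<odot>\<^bsub>D\<^esub> d u) c = a \<otimes>\<^bsub>A\<^esub> br u c"
  using theI'[OF kahler_action_unique] unfolding kahler_action_def Let_def
  by (auto simp: PiE_iff)

lemma derivation_act:
  assumes x: "x \<in> carrier D"
  shows "derivation (act x)"
proof -
  have act_zero: "act \<zero>\<^bsub>D\<^esub> c = \<zero>\<^bsub>A\<^esub>" if "c \<in> carrier A" for c
    using that act_smult[of "\<zero>\<^bsub>A\<^esub>" "\<zero>\<^bsub>D\<^esub>" c] by (simp add: act_closed)
  show ?thesis using x
  proof (induction rule: kahler_induct)
    case zero
    then show ?case by (auto simp: derivation_def act_zero)
  next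
    case (add x y)
    note dx = derivationD[OF add(3)] and dy = derivationD[OF add(4)]
    show ?case
      unfolding derivation_def using add(1,2)
      by (auto simp: act_closed act_add dx dy a_ac r_distr smult_r_distr)
  next
    case (gen a u)
    note du = derivationD[OF derivation_br_right[OF gen(2)]]
    have "a \<otimes>\<^bsub>A\<^esub> (r \<odot>\<^bsub>A\<^esub> br u c) = r \<odot>\<^bsub>A\<^esub> (a \<otimes>\<^bsub>A\<^esub> br u c)"
      if "r \<in> carrier R" "c \<in> carrier A" for r c
      using that gen smult_assoc2[of r "br u c" a] by (simp add: m_comm br_closed)
    then show ?case
      unfolding derivation_def using gen
      by (auto simp: act_closed act_gen du a_ac r_distr m_ac d_closed)
  qed
qed


lemma br_unit_smult:
  assumes "r \<in> carrier R" "c \<in> carrier A"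
  shows "br (r \<odot>\<^bsub>A\<^esub> \<one>\<^bsub>A\<^esub>) c = \<zero>\<^bsub>A\<^esub>"
  using derivation_unit_smult[OF derivation_br_left] assms by simp

text \<open>The operators \<open>E v\<close> will be the maps \<open>x \<mapsto> [x, dv]\<close>. Setting \<open>b = 1\<close> in the formula for the bracket gives
  \<open>[a du, dv] = {a, v} du + a d{u, v}\<close>, which prescribes \<open>E v\<close> as the twisted lift of \<open>u \<mapsto> d{u, v}\<close> along
  \<open>{\<cdot>, v}\<close>.\<close>

lemma lie_derivative_exists:
  obtains E where "\<And>v x. \<lbrakk>v \<in> carrier A; x \<in> carrier D\<rbrakk> \<Longrightarrow> E v x \<in> carrier D"
    and "\<And>v x y. \<lbrakk>v \<in> carrier A; x \<in> carrier D; y \<in> carrier D\<rbrakk> \<Longrightarrow>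
      E v (x \<oplus>\<^bsub>D\<^esub> y) = E v x \<oplus>\<^bsub>D\<^esub> E v y"
    and "\<And>v a x. \<lbrakk>v \<in> carrier A; a \<in> carrier A; x \<in> carrier D\<rbrakk> \<Longrightarrow>
      E v (a \<odot>\<^bsub>D\<^esub> x) = a \<odot>\<^bsub>D\<^esub> E v x \<oplus>\<^bsub>D\<^esub> br a v \<odot>\<^bsub>D\<^esub> x"
    and "\<And>v u. \<lbrakk>v \<in> carrier A; u \<in> carrier A\<rbrakk> \<Longrightarrow> E v (d u) = d (br u v)"
proof -
  let ?Q = "\<lambda>v l. l \<in> carrier D \<rightarrow> carrier D \<and>
    (\<forall>x\<in>carrier D. \<forall>y\<in>carrier D. l (x \<oplus>\<^bsub>D\<^esub> y) = l x \<oplus>\<^bsub>D\<^esub> l y) \<and>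
    (\<forall>a\<in>carrier A. \<forall>x\<in>carrier D. l (a \<odot>\<^bsub>D\<^esub> x) = a \<odot>\<^bsub>D\<^esub> l x \<oplus>\<^bsub>D\<^esub> br a v \<odot>\<^bsub>D\<^esub> x) \<and>
    (\<forall>u\<in>carrier A. l (d u) = d (br u v))"
  have "\<forall>v\<in>carrier A. \<exists>l. ?Q v l"
  proof
    fix v assume v: "v \<in> carrier A"
    note der = derivationD[OF derivation_br_left[OF v]]
    show "\<exists>l. ?Q v l"
      by (rule kahler_twisted_lift[OF derivation_br_left[OF v], of "\<lambda>u. d (br u v)"])
        (simp_all add: der d_closed kahler_d_derivation D.M.a_ac)
  qed
  from bchoice[OF this] obtain E where E: "\<forall>v\<in>carrier A. ?Q v (E v)" ..
  show thesis
    by (rule that[of E]) (use E in \<open>auto simp: Pi_iff\<close>)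
qed

text \<open>For fixed \<open>x\<close>, the map \<open>[x, \<cdot>]\<close> is the twisted lift of \<open>v \<mapsto> [x, dv]\<close> along the action of \<open>x\<close>. The twisted
  product rule that this requires is checked on \<open>x = a du\<close>, since both sides are additive in \<open>x\<close>.\<close>

lemma kahler_bracket_unique:
  "\<exists>!\<beta>. \<beta> \<in> carrier D \<rightarrow>\<^sub>E carrier D \<rightarrow>\<^sub>E carrier D \<and>
      (\<forall>x\<in>carrier D. \<forall>x'\<in>carrier D. \<forall>y\<in>carrier D. \<beta> (x \<oplus>\<^bsub>D\<^esub> x') y = \<beta> x y \<oplus>\<^bsub>D\<^esub> \<beta> x' y) \<and>
      (\<forall>x\<in>carrier D. \<forall>y\<in>carrier D. \<forall>y'\<in>carrier D. \<beta> x (y \<oplus>\<^bsub>D\<^esub> y') = \<beta> x y \<oplus>\<^bsub>D\<^esub> \<beta> x y') \<and>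
      (\<forall>r\<in>carrier R. \<forall>x\<in>carrier D. \<forall>y\<in>carrier D.
        \<beta> ((r \<odot>\<^bsub>A\<^esub> \<one>\<^bsub>A\<^esub>) \<odot>\<^bsub>D\<^esub> x) y = (r \<odot>\<^bsub>A\<^esub> \<one>\<^bsub>A\<^esub>) \<odot>\<^bsub>D\<^esub> \<beta> x y \<and>
        \<beta> x ((r \<odot>\<^bsub>A\<^esub> \<one>\<^bsub>A\<^esub>) \<odot>\<^bsub>D\<^esub> y) = (r \<odot>\<^bsub>A\<^esub> \<one>\<^bsub>A\<^esub>) \<odot>\<^bsub>D\<^esub> \<beta> x y) \<and>
      (\<forall>a\<in>carrier A. \<forall>u\<in>carrier A. \<forall>b\<in>carrier A. \<forall>v\<in>carrier A.
        \<beta> (a \<odot>\<^bsub>D\<^esub> d u) (b \<odot>\<^bsub>D\<^esub> d v) =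
          (a \<otimes>\<^bsub>A\<^esub> br u b) \<odot>\<^bsub>D\<^esub> d v \<oplus>\<^bsub>D\<^esub> (b \<otimes>\<^bsub>A\<^esub> br a v) \<odot>\<^bsub>D\<^esub> d u \<oplus>\<^bsub>D\<^esub> (a \<otimes>\<^bsub>A\<^esub> b) \<odot>\<^bsub>D\<^esub> d (br u v))"
  (is "\<exists>!\<beta>. ?P \<beta>")
proof (rule ex_ex1I)
  obtain E where E_closed: "\<And>v x. \<lbrakk>v \<in> carrier A; x \<in> carrier D\<rbrakk> \<Longrightarrow> E v x \<in> carrier D"
    and E_add: "\<And>v x y. \<lbrakk>v \<in> carrier A; x \<in> carrier D; y \<in> carrier D\<rbrakk> \<Longrightarrow>
      E v (x \<oplus>\<^bsub>D\<^esub> y) = E v x \<oplus>\<^bsub>D\<^esub> E v y"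
    and E_smult: "\<And>v a x. \<lbrakk>v \<in> carrier A; a \<in> carrier A; x \<in> carrier D\<rbrakk> \<Longrightarrow>
      E v (a \<odot>\<^bsub>D\<^esub> x) = a \<odot>\<^bsub>D\<^esub> E v x \<oplus>\<^bsub>D\<^esub> br a v \<odot>\<^bsub>D\<^esub> x"
    and E_d: "\<And>v u. \<lbrakk>v \<in> carrier A; u \<in> carrier A\<rbrakk> \<Longrightarrow> E v (d u) = d (br u v)"
    using lie_derivative_exists by blast
  have E_left_add: "E (v \<oplus>\<^bsub>A\<^esub> w) x = E v x \<oplus>\<^bsub>D\<^esub> E w x"
    if x: "x \<in> carrier D" and vw: "v \<in> carrier A" "w \<in> carrier A" for x v w
    using D.M.abelian_group_axioms x
    by (rule kahler_additive_eqI)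
      (use vw in \<open>simp_all add: E_closed E_add E_smult E_d d_closed br_closed br_add_right
        kahler_d_derivation D.smult_l_distr D.smult_r_distr D.M.a_ac\<close>)
  have E_left_smult: "E (r \<odot>\<^bsub>A\<^esub> v) x = (r \<odot>\<^bsub>A\<^esub> \<one>\<^bsub>A\<^esub>) \<odot>\<^bsub>D\<^esub> E v x"
    if x: "x \<in> carrier D" and rv: "r \<in> carrier R" "v \<in> carrier A" for x r v
    using D.M.abelian_group_axioms x
    by (rule kahler_additive_eqI)
      (use rv in \<open>simp_all add: E_closed E_add E_smult E_d d_closed br_closed br_smult_right
        kahler_d_derivation D.smult_r_distr unit_smult unit_smult'
        flip: D.smult_assoc1\<close>)
  have E_left_mult: "E (v \<otimes>\<^bsub>A\<^esub> w) x =
      (v \<odot>\<^bsub>D\<^esub> E w x \<oplus>\<^bsub>D\<^esub> act x v \<odot>\<^bsub>D\<^esub> d w) \<oplus>\<^bsub>D\<^esub> (w \<odot>\<^bsub>D\<^esub> E v x \<oplus>\<^bsub>D\<^esub> act x w \<odot>\<^bsub>D\<^esub> d v)"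
    if x: "x \<in> carrier D" and vw: "v \<in> carrier A" "w \<in> carrier A" for x v w
    using D.M.abelian_group_axioms x
  proof (rule kahler_additive_eqI)
    fix a u assume au: "a \<in> carrier A" "u \<in> carrier A"
    show "E (v \<otimes>\<^bsub>A\<^esub> w) (a \<odot>\<^bsub>D\<^esub> d u) =
        (v \<odot>\<^bsub>D\<^esub> E w (a \<odot>\<^bsub>D\<^esub> d u) \<oplus>\<^bsub>D\<^esub> act (a \<odot>\<^bsub>D\<^esub> d u) v \<odot>\<^bsub>D\<^esub> d w) \<oplus>\<^bsub>D\<^esub>
        (w \<odot>\<^bsub>D\<^esub> E v (a \<odot>\<^bsub>D\<^esub> d u) \<oplus>\<^bsub>D\<^esub> act (a \<odot>\<^bsub>D\<^esub> d u) w \<odot>\<^bsub>D\<^esub> d v)"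
      using au vw
      by (simp add: E_smult E_d act_gen d_closed br_closed kahler_d_derivation m_ac
          derivationD(4)[OF derivation_br_right] D.smult_l_distr D.smult_r_distr
          D.smult_assoc1[symmetric] D.M.a_ac)
  qed (use vw in \<open>simp_all add: E_closed E_add act_add act_closed d_closed
        D.smult_l_distr D.smult_r_distr D.M.a_ac\<close>)
  let ?Q = "\<lambda>x l. l \<in> carrier D \<rightarrow> carrier D \<and>
    (\<forall>y\<in>carrier D. \<forall>z\<in>carrier D. l (y \<oplus>\<^bsub>D\<^esub> z) = l y \<oplus>\<^bsub>D\<^esub> l z) \<and>
    (\<forall>b\<in>carrier A. \<forall>y\<in>carrier D. l (b \<odot>\<^bsub>D\<^esub> y) = b \<odot>\<^bsub>D\<^esub> l y \<oplus>\<^bsub>D\<^esub> act x b \<odot>\<^bsub>D\<^esub> y) \<and>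
    (\<forall>v\<in>carrier A. l (d v) = E v x)"
  have "\<forall>x\<in>carrier D. \<exists>l. ?Q x l"
  proof
    fix x assume x: "x \<in> carrier D"
    show "\<exists>l. ?Q x l"
      by (rule kahler_twisted_lift[OF derivation_act[OF x], of "\<lambda>v. E v x"])
        (simp_all add: x E_closed E_left_add E_left_smult E_left_mult)
  qed
  from bchoice[OF this] obtain B where B: "\<forall>x\<in>carrier D. ?Q x (B x)" ..
  have B_closed: "B x y \<in> carrier D" if "x \<in> carrier D" "y \<in> carrier D" for x y
    using B that by blast
  have B_add: "B x (y \<oplus>\<^bsub>D\<^esub> z) = B x y \<oplus>\<^bsub>D\<^esub> B x z"
    if "x \<in> carrier D" "y \<in> carrier D" "z \<in> carrier D" for x y z
    using B that by blast
  have B_smult: "B x (b \<odot>\<^bsub>D\<^esub> y) = b \<odot>\<^bsub>D\<^esub> B x y \<oplus>\<^bsub>D\<^esub> act x b \<odot>\<^bsub>D\<^esub> y"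
    if "x \<in> carrier D" "y \<in> carrier D" "b \<in> carrier A" for x y b
    using B that by blast
  have B_d: "B x (d v) = E v x" if "x \<in> carrier D" "v \<in> carrier A" for x v
    using B that by blast
  have B_left_add: "B (x \<oplus>\<^bsub>D\<^esub> x') y = B x y \<oplus>\<^bsub>D\<^esub> B x' y"
    if y: "y \<in> carrier D" and xs: "x \<in> carrier D" "x' \<in> carrier D" for x x' y
    using D.M.abelian_group_axioms y
    by (rule kahler_additive_eqI)
      (use xs in \<open>simp_all add: B_closed B_add B_smult B_d E_closed E_add act_add act_closed d_closed
        D.smult_l_distr D.smult_r_distr D.M.a_ac\<close>)
  have B_left_smult: "B ((r \<odot>\<^bsub>A\<^esub> \<one>\<^bsub>A\<^esub>) \<odot>\<^bsub>D\<^esub> x) y = (r \<odot>\<^bsub>A\<^esub> \<one>\<^bsub>A\<^esub>) \<odot>\<^bsub>D\<^esub> B x y"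
    if y: "y \<in> carrier D" and rx: "r \<in> carrier R" "x \<in> carrier D" for r x y
    using D.M.abelian_group_axioms y
  proof (rule kahler_additive_eqI)
    fix b v assume bv: "b \<in> carrier A" "v \<in> carrier A"
    show "B ((r \<odot>\<^bsub>A\<^esub> \<one>\<^bsub>A\<^esub>) \<odot>\<^bsub>D\<^esub> x) (b \<odot>\<^bsub>D\<^esub> d v) = (r \<odot>\<^bsub>A\<^esub> \<one>\<^bsub>A\<^esub>) \<odot>\<^bsub>D\<^esub> B x (b \<odot>\<^bsub>D\<^esub> d v)"
      using rx bv
      by (simp add: B_smult B_d E_closed E_smult br_unit_smult act_smult act_closed d_closed
          D.smult_r_distr m_comm flip: D.smult_assoc1)
  qed (use rx in \<open>simp_all add: B_closed B_add D.smult_r_distr\<close>)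
  have B_right_smult: "B x ((r \<odot>\<^bsub>A\<^esub> \<one>\<^bsub>A\<^esub>) \<odot>\<^bsub>D\<^esub> y) = (r \<odot>\<^bsub>A\<^esub> \<one>\<^bsub>A\<^esub>) \<odot>\<^bsub>D\<^esub> B x y"
    if "x \<in> carrier D" "y \<in> carrier D" "r \<in> carrier R" for x y r
    using that by (simp add: B_smult B_closed derivation_unit_smult[OF derivation_act])
  have B_gen: "B (a \<odot>\<^bsub>D\<^esub> d u) (b \<odot>\<^bsub>D\<^esub> d v) =
      (a \<otimes>\<^bsub>A\<^esub> br u b) \<odot>\<^bsub>D\<^esub> d v \<oplus>\<^bsub>D\<^esub> (b \<otimes>\<^bsub>A\<^esub> br a v) \<odot>\<^bsub>D\<^esub> d u \<oplus>\<^bsub>D\<^esub> (a \<otimes>\<^bsub>A\<^esub> b) \<odot>\<^bsub>D\<^esub> d (br u v)"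
    if "a \<in> carrier A" "u \<in> carrier A" "b \<in> carrier A" "v \<in> carrier A" for a u b v
    using that
    by (simp add: B_smult B_d E_smult E_d act_gen d_closed br_closed m_comm
        D.smult_r_distr D.M.a_ac flip: D.smult_assoc1)
  have "?P (\<lambda>x\<in>carrier D. \<lambda>y\<in>carrier D. B x y)"
    by (auto simp: B_closed B_add B_left_add B_left_smult B_right_smult B_gen d_closed)
  then show "\<exists>\<beta>. ?P \<beta>" by (rule exI[where P = ?P])
next
  fix \<beta> \<gamma> assume P: "?P \<beta>" "?P \<gamma>"
  note ext = P[THEN conjunct1]
  have closed: "\<beta> x y \<in> carrier D" "\<gamma> x y \<in> carrier D" if "x \<in> carrier D" "y \<in> carrier D" for x y
    using ext that by (auto simp: PiE_iff)
  have "\<beta> x y = \<gamma> x y" if x: "x \<in> carrier D" and y: "y \<in> carrier D" for x y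
    using D.M.abelian_group_axioms x
  proof (rule kahler_additive_eqI)
    fix a u assume au: "a \<in> carrier A" "u \<in> carrier A"
    then have adu: "a \<odot>\<^bsub>D\<^esub> d u \<in> carrier D" by (simp add: d_closed)
    show "\<beta> (a \<odot>\<^bsub>D\<^esub> d u) y = \<gamma> (a \<odot>\<^bsub>D\<^esub> d u) y"
      using D.M.abelian_group_axioms y
      by (rule kahler_additive_eqI) (use P au adu in \<open>simp_all add: closed\<close>)
  qed (use P y in \<open>simp_all add: closed\<close>)
  then show "\<beta> = \<gamma>"
    by (rule PiE_ext2[OF ext])
qed

abbreviation bracket where "bracket \<equiv> kahler_bracket R A br"

lemma kahler_bracket:
  shows bracket_closed: "\<lbrakk>x \<in> carrier D; y \<in> carrier D\<rbrakk> \<Longrightarrow> bracket x y \<in> carrier D"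
    and bracket_add_left: "\<lbrakk>x \<in> carrier D; x' \<in> carrier D; y \<in> carrier D\<rbrakk> \<Longrightarrow>
      bracket (x \<oplus>\<^bsub>D\<^esub> x') y = bracket x y \<oplus>\<^bsub>D\<^esub> bracket x' y"
    and bracket_add_right: "\<lbrakk>x \<in> carrier D; y \<in> carrier D; y' \<in> carrier D\<rbrakk> \<Longrightarrow>
      bracket x (y \<oplus>\<^bsub>D\<^esub> y') = bracket x y \<oplus>\<^bsub>D\<^esub> bracket x y'"
    and bracket_gen: "\<lbrakk>a \<in> carrier A; u \<in> carrier A; b \<in> carrier A; v \<in> carrier A\<rbrakk> \<Longrightarrow>
      bracket (a \<odot>\<^bsub>D\<^esub> d u) (b \<odot>\<^bsub>D\<^esub> d v) =
        (a \<otimes>\<^bsub>A\<^esub> br u b) \<odot>\<^bsub>D\<^esub> d v \<oplus>\<^bsub>D\<^esub> (b \<otimes>\<^bsub>A\<^esub> br a v) \<odot>\<^bsub>D\<^esub> d u \<oplus>\<^bsub>D\<^esub> (a \<otimes>\<^bsub>A\<^esub> b) \<odot>\<^bsub>D\<^esub> d (br u v)"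
  using theI'[OF kahler_bracket_unique] unfolding kahler_bracket_def Let_def
  by (auto simp: PiE_iff)


section \<open>The Poisson 2-form\<close>

lemma poisson_form_pairing:
  assumes p: "is_poisson_form R A br p"
  shows "\<lbrakk>x \<in> carrier D; y \<in> carrier D\<rbrakk> \<Longrightarrow> p (ktensor R A x y) \<in> carrier A"
    and "\<lbrakk>x \<in> carrier D; x' \<in> carrier D; y \<in> carrier D\<rbrakk> \<Longrightarrow>
      p (ktensor R A (x \<oplus>\<^bsub>D\<^esub> x') y) = p (ktensor R A x y) \<oplus>\<^bsub>A\<^esub> p (ktensor R A x' y)"
    and "\<lbrakk>x \<in> carrier D; y \<in> carrier D; y' \<in> carrier D\<rbrakk> \<Longrightarrow>
      p (ktensor R A x (y \<oplus>\<^bsub>D\<^esub> y')) = p (ktensor R A x y) \<oplus>\<^bsub>A\<^esub> p (ktensor R A x y')"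
    and "\<lbrakk>a \<in> carrier A; x \<in> carrier D; y \<in> carrier D\<rbrakk> \<Longrightarrow>
      p (ktensor R A (a \<odot>\<^bsub>D\<^esub> x) y) = a \<otimes>\<^bsub>A\<^esub> p (ktensor R A x y)"
    and "\<lbrakk>a \<in> carrier A; x \<in> carrier D; y \<in> carrier D\<rbrakk> \<Longrightarrow>
      p (ktensor R A x (a \<odot>\<^bsub>D\<^esub> y)) = a \<otimes>\<^bsub>A\<^esub> p (ktensor R A x y)"
    and "\<lbrakk>a \<in> carrier A; u \<in> carrier A; b \<in> carrier A; v \<in> carrier A\<rbrakk> \<Longrightarrow>
      p (ktensor R A (a \<odot>\<^bsub>D\<^esub> d u) (b \<odot>\<^bsub>D\<^esub> d v)) = a \<otimes>\<^bsub>A\<^esub> b \<otimes>\<^bsub>A\<^esub> br u v"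
  using p tensor_closed[OF kahler_module kahler_module] tensor_bilinear[OF kahler_module kahler_module]
  unfolding is_poisson_form_def Let_def
  by (auto simp: PiE_iff)

text \<open>For existence, the action of \<open>x\<close> is a derivation of \<open>A\<close> and extends to a linear map \<open>B x\<close> on \<open>D\<close>, with
  \<open>B x (dv) = x(v)\<close>. The form \<open>B\<close> is linear in \<open>x\<close> too, because it is so at \<open>b dv\<close>.\<close>

lemma poisson_form_unique: "\<exists>!p. is_poisson_form R A br p"
proof (rule ex_ex1I)
  let ?A = "regular_module A"
  have reg: "module A ?A" using is_cring by (rule regular_module_module)
  have "\<forall>x\<in>carrier D. \<exists>k. linear_map A D ?A k \<and> (\<forall>v\<in>carrier A. k (d v) = act x v)"
  proof
    fix x assume x: "x \<in> carrier D"
    note der = derivationD[OF derivation_act[OF x]]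
    obtain k where "linear_map A D ?A k" "\<And>v. v \<in> carrier A \<Longrightarrow> k (d v) = act x v"
      by (rule kahler_lift[OF reg, of "act x"]) (simp_all add: der x act_closed unit_smult)
    then show "\<exists>k. linear_map A D ?A k \<and> (\<forall>v\<in>carrier A. k (d v) = act x v)" by blast
  qed
  from bchoice[OF this] obtain B
    where B: "\<forall>x\<in>carrier D. linear_map A D ?A (B x) \<and> (\<forall>v\<in>carrier A. B x (d v) = act x v)" ..
  then have B_linear: "linear_map A D ?A (B x)" if "x \<in> carrier D" for x
    using that by blast
  note BD = linear_mapD[OF B_linear, simplified]
  have B_d: "B x (d v) = act x v" if "x \<in> carrier D" "v \<in> carrier A" for x v
    using B that by blast
  have B_left: "linear_map A D ?A (\<lambda>x. B x y)" if y: "y \<in> carrier D" for y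
  proof (rule linear_mapI)
    show "B x y \<in> carrier ?A" if "x \<in> carrier D" for x using that y by (simp add: BD)
    show "B (x \<oplus>\<^bsub>D\<^esub> x') y = B x y \<oplus>\<^bsub>?A\<^esub> B x' y" if "x \<in> carrier D" "x' \<in> carrier D" for x x'
      unfolding regular_module_simps
      using abelian_group_axioms y
      by (rule kahler_additive_eqI)
        (use that in \<open>simp_all add: BD B_d d_closed act_add act_closed r_distr a_ac\<close>)
    show "B (a \<odot>\<^bsub>D\<^esub> x) y = a \<odot>\<^bsub>?A\<^esub> B x y" if "a \<in> carrier A" "x \<in> carrier D" for a x
      unfolding regular_module_simps
      using abelian_group_axioms y
      by (rule kahler_additive_eqI)
        (use that in \<open>simp_all add: BD B_d d_closed act_smult act_closed r_distr m_ac\<close>)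
  qed
  obtain k where k: "linear_map A (kahler_tensor R A) ?A k"
    and kB: "\<And>x y. \<lbrakk>x \<in> carrier D; y \<in> carrier D\<rbrakk> \<Longrightarrow> k (ktensor R A x y) = B x y"
    using tensor_module_lift[OF kahler_module kahler_module reg B_left B_linear] by blast
  interpret T: module A "kahler_tensor R A"
    using kahler_module kahler_module by (rule tensor_module_module)
  have "is_poisson_form R A br (restrict k (carrier (kahler_tensor R A)))"
    unfolding is_poisson_form_def Let_def
    by (auto simp: linear_mapD[OF k, simplified] kB tensor_closed[OF kahler_module kahler_module]
        d_closed BD B_d act_gen m_ac br_closed)
  then show "\<exists>p. is_poisson_form R A br p"
    by (rule exI[where P = "is_poisson_form R A br"])
next
  fix p q assume pq: "is_poisson_form R A br p" "is_poisson_form R A br q"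
  note P = poisson_form_pairing[OF pq(1)] and Q = poisson_form_pairing[OF pq(2)]
  have on_tensors: "p (ktensor R A x y) = q (ktensor R A x y)"
    if x: "x \<in> carrier D" and y: "y \<in> carrier D" for x y
    using abelian_group_axioms x
  proof (rule kahler_additive_eqI)
    fix a u assume au: "a \<in> carrier A" "u \<in> carrier A"
    then have adu: "a \<odot>\<^bsub>D\<^esub> d u \<in> carrier D" by (simp add: d_closed)
    show "p (ktensor R A (a \<odot>\<^bsub>D\<^esub> d u) y) = q (ktensor R A (a \<odot>\<^bsub>D\<^esub> d u) y)"
      using abelian_group_axioms y
      by (rule kahler_additive_eqI)
        (use au adu in \<open>simp_all add: P(1,3,6) Q(1,3,6)\<close>)
  qed (use y in \<open>simp_all add: P(1,2) Q(1,2)\<close>)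
  have pq': "p \<in> carrier (kahler_tensor R A) \<rightarrow>\<^sub>E carrier A"
      "q \<in> carrier (kahler_tensor R A) \<rightarrow>\<^sub>E carrier A"
    using pq unfolding is_poisson_form_def Let_def by blast+
  interpret T: module A "kahler_tensor R A"
    using kahler_module kahler_module by (rule tensor_module_module)
  have add: "p (s \<oplus>\<^bsub>kahler_tensor R A\<^esub> t) = p s \<oplus>\<^bsub>A\<^esub> p t" "q (s \<oplus>\<^bsub>kahler_tensor R A\<^esub> t) = q s \<oplus>\<^bsub>A\<^esub> q t"
    if "s \<in> carrier (kahler_tensor R A)" "t \<in> carrier (kahler_tensor R A)" for s t
    using pq that unfolding is_poisson_form_def Let_def by blast+
  show "p = q"
  proof (rule PiE_ext[OF pq'])
    fix t assume "t \<in> carrier (kahler_tensor R A)"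
    with kahler_module kahler_module show "p t = q t"
    proof (induction rule: tensor_module_induct)
      case zero
      then show ?case
        using pq' additive_zero[OF T.M.abelian_group_axioms abelian_group_axioms, of p]
          additive_zero[OF T.M.abelian_group_axioms abelian_group_axioms, of q] add
        by (simp add: PiE_iff)
    qed (simp_all add: add on_tensors)
  qed
qed

lemma poisson_form: "is_poisson_form R A br (poisson_form R A br)"
  unfolding poisson_form_def using poisson_form_unique by (rule theI')

definition pairing where "pairing x y = poisson_form R A br (ktensor R A x y)"

lemmas pairing_closed = poisson_form_pairing(1)[OF poisson_form, folded pairing_def]
  and pairing_add_left = poisson_form_pairing(2)[OF poisson_form, folded pairing_def]
  and pairing_add_right = poisson_form_pairing(3)[OF poisson_form, folded pairing_def]
  and pairing_smult_left = poisson_form_pairing(4)[OF poisson_form, folded pairing_def]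
  and pairing_smult_right = poisson_form_pairing(5)[OF poisson_form, folded pairing_def]
  and pairing_gen = poisson_form_pairing(6)[OF poisson_form, folded pairing_def]

lemma pairing_skew:
  assumes x: "x \<in> carrier D" and y: "y \<in> carrier D"
  shows "pairing x y \<oplus>\<^bsub>A\<^esub> pairing y x = \<zero>\<^bsub>A\<^esub>"
proof (rule kahler_additive_eqI[OF abelian_group_axioms x])
  fix a u assume au: "a \<in> carrier A" "u \<in> carrier A"
  then have adu: "a \<odot>\<^bsub>D\<^esub> d u \<in> carrier D" by (simp add: d_closed)
  show "pairing (a \<odot>\<^bsub>D\<^esub> d u) y \<oplus>\<^bsub>A\<^esub> pairing y (a \<odot>\<^bsub>D\<^esub> d u) = \<zero>\<^bsub>A\<^esub>"
  proof (rule kahler_additive_eqI[OF abelian_group_axioms y])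
    fix b v assume bv: "b \<in> carrier A" "v \<in> carrier A"
    show "pairing (a \<odot>\<^bsub>D\<^esub> d u) (b \<odot>\<^bsub>D\<^esub> d v) \<oplus>\<^bsub>A\<^esub> pairing (b \<odot>\<^bsub>D\<^esub> d v) (a \<odot>\<^bsub>D\<^esub> d u) = \<zero>\<^bsub>A\<^esub>"
      using au bv br_skew[of u v] by (simp add: pairing_gen br_closed r_minus r_neg m_comm[of b a])
  qed (use adu in \<open>simp_all add: pairing_closed pairing_add_left pairing_add_right a_ac\<close>)
qed (use y in \<open>simp_all add: pairing_closed pairing_add_left pairing_add_right a_ac\<close>)

text \<open>The map \<open>x \<mapsto> pairing x x\<close> is quadratic, and its cross terms cancel by skew symmetry.\<close>

lemma pairing_self:
  assumes "x \<in> carrier D"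
  shows "pairing x x = \<zero>\<^bsub>A\<^esub>"
  using assms
proof (induction rule: kahler_induct)
  case zero
  show ?case using pairing_smult_left[of "\<zero>\<^bsub>A\<^esub>" "\<zero>\<^bsub>D\<^esub>" "\<zero>\<^bsub>D\<^esub>"] by (simp add: pairing_closed)
next
  case (add x y)
  then show ?case
    using pairing_skew[of y x] by (simp add: pairing_closed pairing_add_left pairing_add_right)
next
  case (gen a u)
  then show ?case by (simp add: pairing_gen br_self)
qed


section \<open>The cocycle condition\<close>

text \<open>The differential of the pairing in degree 3, without the overall sign.\<close>

definition coboundary where
  "coboundary x y z =
    act x (pairing y z) \<ominus>\<^bsub>A\<^esub> act y (pairing x z) \<oplus>\<^bsub>A\<^esub> act z (pairing x y) \<ominus>\<^bsub>A\<^esub>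
    pairing (bracket x y) z \<oplus>\<^bsub>A\<^esub> pairing (bracket x z) y \<ominus>\<^bsub>A\<^esub> pairing (bracket y z) x"

lemma coboundary_closed:
  "\<lbrakk>x \<in> carrier D; y \<in> carrier D; z \<in> carrier D\<rbrakk> \<Longrightarrow> coboundary x y z \<in> carrier A"
  by (simp add: coboundary_def pairing_closed act_closed bracket_closed)

lemma act_add_right:
  "\<lbrakk>x \<in> carrier D; a \<in> carrier A; b \<in> carrier A\<rbrakk> \<Longrightarrow> act x (a \<oplus>\<^bsub>A\<^esub> b) = act x a \<oplus>\<^bsub>A\<^esub> act x b"
  using derivationD(2)[OF derivation_act] .

lemma coboundary_additive:
  shows "\<lbrakk>x \<in> carrier D; x' \<in> carrier D; y \<in> carrier D; z \<in> carrier D\<rbrakk> \<Longrightarrow>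
      coboundary (x \<oplus>\<^bsub>D\<^esub> x') y z = coboundary x y z \<oplus>\<^bsub>A\<^esub> coboundary x' y z"
    and "\<lbrakk>x \<in> carrier D; y \<in> carrier D; y' \<in> carrier D; z \<in> carrier D\<rbrakk> \<Longrightarrow>
      coboundary x (y \<oplus>\<^bsub>D\<^esub> y') z = coboundary x y z \<oplus>\<^bsub>A\<^esub> coboundary x y' z"
    and "\<lbrakk>x \<in> carrier D; y \<in> carrier D; z \<in> carrier D; z' \<in> carrier D\<rbrakk> \<Longrightarrow>
      coboundary x y (z \<oplus>\<^bsub>D\<^esub> z') = coboundary x y z \<oplus>\<^bsub>A\<^esub> coboundary x y z'"
  by (simp_all add: coboundary_def pairing_closed act_closed bracket_closed pairing_add_left
      pairing_add_right act_add act_add_right bracket_add_left bracket_add_right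
      minus_eq minus_add a_ac)

text \<open>Every bracket is rewritten in terms of the nine elements \<open>cl\<close> and
  of the three Jacobi terms \<open>j1\<close>, \<open>j2\<close>, \<open>j3\<close>. The Jacobi identity eliminates \<open>j1\<close>, and what is left is an
  identity in the commutative ring \<open>A\<close>.\<close>

lemma coboundary_gen:
  assumes a: "a \<in> carrier A" and b: "b \<in> carrier A" and c: "c \<in> carrier A"
    and u: "u \<in> carrier A" and v: "v \<in> carrier A" and w: "w \<in> carrier A"
  shows "coboundary (a \<odot>\<^bsub>D\<^esub> d u) (b \<odot>\<^bsub>D\<^esub> d v) (c \<odot>\<^bsub>D\<^esub> d w) = \<zero>\<^bsub>A\<^esub>"
proof -
  note carr = assms
  have br: "br p q \<in> carrier A" if "p \<in> carrier A" "q \<in> carrier A" for p q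
    using that by (rule br_closed)
  have D: "p \<odot>\<^bsub>D\<^esub> d q \<in> carrier D" if "p \<in> carrier A" "q \<in> carrier A" for p q
    using that by (simp add: d_closed)
  have act3: "act (a \<odot>\<^bsub>D\<^esub> d u) (b \<otimes>\<^bsub>A\<^esub> c \<otimes>\<^bsub>A\<^esub> e) =
      a \<otimes>\<^bsub>A\<^esub> (b \<otimes>\<^bsub>A\<^esub> c \<otimes>\<^bsub>A\<^esub> br u e \<oplus>\<^bsub>A\<^esub> e \<otimes>\<^bsub>A\<^esub> (b \<otimes>\<^bsub>A\<^esub> br u c \<oplus>\<^bsub>A\<^esub> c \<otimes>\<^bsub>A\<^esub> br u b))"
    if "a \<in> carrier A" "b \<in> carrier A" "c \<in> carrier A" "e \<in> carrier A" "u \<in> carrier A" for a b c e u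
    using that by (simp add: act_gen derivationD(4)[OF derivation_br_right] br)
  have pair3: "pairing (bracket (a \<odot>\<^bsub>D\<^esub> d u) (b \<odot>\<^bsub>D\<^esub> d v)) (c \<odot>\<^bsub>D\<^esub> d w) =
      a \<otimes>\<^bsub>A\<^esub> br u b \<otimes>\<^bsub>A\<^esub> c \<otimes>\<^bsub>A\<^esub> br v w \<oplus>\<^bsub>A\<^esub> b \<otimes>\<^bsub>A\<^esub> br a v \<otimes>\<^bsub>A\<^esub> c \<otimes>\<^bsub>A\<^esub> br u w \<oplus>\<^bsub>A\<^esub>
      a \<otimes>\<^bsub>A\<^esub> b \<otimes>\<^bsub>A\<^esub> c \<otimes>\<^bsub>A\<^esub> br (br u v) w"
    if "a \<in> carrier A" "b \<in> carrier A" "c \<in> carrier A" "u \<in> carrier A" "v \<in> carrier A" "w \<in> carrier A"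
    for a b c u v w
    using that by (simp add: bracket_gen pairing_add_left pairing_gen D br)
  define j1 j2 j3 where j: "j1 = br u (br v w)" "j2 = br v (br w u)" "j3 = br w (br u v)"
  have jc: "j1 \<in> carrier A" "j2 \<in> carrier A" "j3 \<in> carrier A"
    using carr by (simp_all add: j br)
  have "j1 \<oplus>\<^bsub>A\<^esub> j2 \<oplus>\<^bsub>A\<^esub> j3 = \<zero>\<^bsub>A\<^esub>"
    using br_jacobi[of u v w] carr by (simp add: j)
  then have j1: "j1 = \<ominus>\<^bsub>A\<^esub> (j2 \<oplus>\<^bsub>A\<^esub> j3)"
    using jc by (metis a_assoc a_closed minus_equality)
  have neg: "br p (\<ominus>\<^bsub>A\<^esub> q) = \<ominus>\<^bsub>A\<^esub> br p q" if "p \<in> carrier A" "q \<in> carrier A" for p q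
    using that additive_minus[OF abelian_group_axioms abelian_group_axioms, of "br p" q]
    by (simp add: br br_add_right)
  have nest: "br v (br u w) = \<ominus>\<^bsub>A\<^esub> j2" "br (br u v) w = \<ominus>\<^bsub>A\<^esub> j3" "br (br u w) v = j2"
    "br (br v w) u = \<ominus>\<^bsub>A\<^esub> j1"
    using carr br_skew[of w u] br_skew[of w "br u v"] br_skew[of v "br u w"] br_skew[of u "br v w"]
    by (simp_all add: j br neg)
  have skew: "br w v = \<ominus>\<^bsub>A\<^esub> br v w" "br w u = \<ominus>\<^bsub>A\<^esub> br u w" "br v u = \<ominus>\<^bsub>A\<^esub> br u v"
    "br a v = \<ominus>\<^bsub>A\<^esub> br v a" "br a w = \<ominus>\<^bsub>A\<^esub> br w a" "br b w = \<ominus>\<^bsub>A\<^esub> br w b"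
    using carr br_skew by blast+
  have cl: "br v w \<in> carrier A" "br u w \<in> carrier A" "br u v \<in> carrier A"
    "br v a \<in> carrier A" "br w a \<in> carrier A" "br w b \<in> carrier A"
    "br u b \<in> carrier A" "br u c \<in> carrier A" "br v c \<in> carrier A"
    using carr by (simp_all add: br)
  show ?thesis
    unfolding coboundary_def act3[OF a b c cl(1) u] act3[OF b a c cl(2) v] act3[OF c a b cl(3) w]
      pair3[OF a b c u v w] pair3[OF a c b u w v] pair3[OF b c a v w u]
      pairing_gen[OF b v c w] pairing_gen[OF a u c w] pairing_gen[OF a u b v]
      nest j(1)[symmetric] j(3)[symmetric] skew j1
    using carr cl jc by algebra
qed

lemma coboundary_zero:
  assumes x: "x \<in> carrier D" and y: "y \<in> carrier D" and z: "z \<in> carrier D"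
  shows "coboundary x y z = \<zero>\<^bsub>A\<^esub>"
proof (rule kahler_additive_eqI[OF abelian_group_axioms x])
  fix a u assume au: "a \<in> carrier A" "u \<in> carrier A"
  then have adu: "a \<odot>\<^bsub>D\<^esub> d u \<in> carrier D" by (simp add: d_closed)
  show "coboundary (a \<odot>\<^bsub>D\<^esub> d u) y z = \<zero>\<^bsub>A\<^esub>"
  proof (rule kahler_additive_eqI[OF abelian_group_axioms y])
    fix b v assume bv: "b \<in> carrier A" "v \<in> carrier A"
    then have bdv: "b \<odot>\<^bsub>D\<^esub> d v \<in> carrier D" by (simp add: d_closed)
    show "coboundary (a \<odot>\<^bsub>D\<^esub> d u) (b \<odot>\<^bsub>D\<^esub> d v) z = \<zero>\<^bsub>A\<^esub>"
      by (rule kahler_additive_eqI[OF abelian_group_axioms z])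
        (use au bv adu bdv in \<open>simp_all add: coboundary_closed coboundary_additive coboundary_gen\<close>)
  qed (use adu z in \<open>simp_all add: coboundary_closed coboundary_additive\<close>)
qed (use y z in \<open>simp_all add: coboundary_closed coboundary_additive\<close>)

lemma tuples_kahler_lie: "tuples (kahler_lie R A br) n = tuples D n"
  by (simp add: tuples_def kahler_lie_def Let_def)

lemma kahler_lie_simps:
  "carrier (kahler_lie R A br) = carrier D"
  "x \<oplus>\<^bsub>kahler_lie R A br\<^esub> y = x \<oplus>\<^bsub>D\<^esub> y"
  "a \<odot>\<^bsub>kahler_lie R A br\<^esub> x = a \<odot>\<^bsub>D\<^esub> x"
  "lbracket (kahler_lie R A br) = bracket"
  "laction (kahler_lie R A br) = act"
  by (simp_all add: kahler_lie_def Let_def)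

lemma tuples_2: "xs \<in> tuples D 2 \<longleftrightarrow> (\<exists>x\<in>carrier D. \<exists>y\<in>carrier D. xs = [x, y])"
  by (auto simp: tuples_def length_Suc_conv numeral_2_eq_2)

lemma tuples_3:
  "xs \<in> tuples D 3 \<longleftrightarrow> (\<exists>x\<in>carrier D. \<exists>y\<in>carrier D. \<exists>z\<in>carrier D. xs = [x, y, z])"
  by (auto simp: tuples_def length_Suc_conv numeral_3_eq_3)

lemma poisson_cochain_eq:
  "\<lbrakk>x \<in> carrier D; y \<in> carrier D\<rbrakk> \<Longrightarrow> poisson_cochain R A br [x, y] = pairing x y"
  by (simp add: poisson_cochain_def pairing_def tuples_2)

lemma poisson_cochain_alt_form:
  "poisson_cochain R A br \<in> carrier (alt_forms A (kahler_lie R A br) 2)"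
proof -
  let ?f = "poisson_cochain R A br"
  have "?f \<in> tuples D 2 \<rightarrow>\<^sub>E carrier A"
  proof (rule PiE_I)
    show "?f xs \<in> carrier A" if "xs \<in> tuples D 2" for xs
      using that by (auto simp: tuples_2 poisson_cochain_eq pairing_closed)
  qed (simp add: poisson_cochain_def)
  moreover have "multilinear A (kahler_lie R A br) 2 ?f"
    unfolding multilinear_def kahler_lie_simps tuples_kahler_lie
  proof (intro ballI allI impI)
    fix xs and i :: nat assume "xs \<in> tuples D 2" "i < 2"
    then obtain x y where "x \<in> carrier D" "y \<in> carrier D" "xs = [x, y]"
      unfolding tuples_2 by blast
    moreover have "i = 0 \<or> i = 1" using \<open>i < 2\<close> by auto
    ultimately show "(\<forall>x\<in>carrier D. \<forall>y\<in>carrier D. ?f (xs[i := x \<oplus>\<^bsub>D\<^esub> y]) = ?f (xs[i := x]) \<oplus>\<^bsub>A\<^esub> ?f (xs[i := y])) \<and>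
        (\<forall>a\<in>carrier A. \<forall>x\<in>carrier D. ?f (xs[i := a \<odot>\<^bsub>D\<^esub> x]) = a \<otimes>\<^bsub>A\<^esub> ?f (xs[i := x]))"
      by (elim disjE) (simp_all add: poisson_cochain_eq pairing_add_left pairing_add_right
          pairing_smult_left pairing_smult_right)
  qed
  moreover have "alternating A (kahler_lie R A br) 2 ?f"
    by (auto simp: alternating_def tuples_kahler_lie tuples_2 poisson_cochain_eq pairing_self)
  ultimately show ?thesis
    by (simp add: alt_forms_def tuples_kahler_lie)
qed

lemma signed_eq:
  assumes "x \<in> carrier A"
  shows "signed A k x = (if even k then x else \<ominus>\<^bsub>A\<^esub> x)"
proof -
  have "(\<ominus>\<^bsub>A\<^esub> \<one>\<^bsub>A\<^esub>) [^]\<^bsub>A\<^esub> k = (if even k then \<one>\<^bsub>A\<^esub> else \<ominus>\<^bsub>A\<^esub> \<one>\<^bsub>A\<^esub>)"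
    by (induction k) (simp_all add: l_minus)
  then show ?thesis using assms by (simp add: signed_def l_minus)
qed

lemma finsum_lessThan_small:
  fixes f :: "nat \<Rightarrow> _"
  shows "(\<Oplus>\<^bsub>A\<^esub>i\<in>{..<0::nat}. f i) = \<zero>\<^bsub>A\<^esub>"
    and "f 0 \<in> carrier A \<Longrightarrow> (\<Oplus>\<^bsub>A\<^esub>i\<in>{..<1}. f i) = f 0"
    and "\<lbrakk>f 0 \<in> carrier A; f 1 \<in> carrier A\<rbrakk> \<Longrightarrow> (\<Oplus>\<^bsub>A\<^esub>i\<in>{..<2}. f i) = f 0 \<oplus>\<^bsub>A\<^esub> f 1"
    and "\<lbrakk>f 0 \<in> carrier A; f 1 \<in> carrier A; f 2 \<in> carrier A\<rbrakk> \<Longrightarrow>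
      (\<Oplus>\<^bsub>A\<^esub>i\<in>{..<3}. f i) = f 0 \<oplus>\<^bsub>A\<^esub> f 1 \<oplus>\<^bsub>A\<^esub> f 2"
proof -
  have sets: "{..<1::nat} = {0}" "{..<2::nat} = {1, 0}" "{..<3::nat} = {2, 1, 0}"
    by auto
  show "(\<Oplus>\<^bsub>A\<^esub>i\<in>{..<0::nat}. f i) = \<zero>\<^bsub>A\<^esub>"
    and "f 0 \<in> carrier A \<Longrightarrow> (\<Oplus>\<^bsub>A\<^esub>i\<in>{..<1}. f i) = f 0"
    and "\<lbrakk>f 0 \<in> carrier A; f 1 \<in> carrier A\<rbrakk> \<Longrightarrow> (\<Oplus>\<^bsub>A\<^esub>i\<in>{..<2}. f i) = f 0 \<oplus>\<^bsub>A\<^esub> f 1"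
    and "\<lbrakk>f 0 \<in> carrier A; f 1 \<in> carrier A; f 2 \<in> carrier A\<rbrakk> \<Longrightarrow>
      (\<Oplus>\<^bsub>A\<^esub>i\<in>{..<3}. f i) = f 0 \<oplus>\<^bsub>A\<^esub> f 1 \<oplus>\<^bsub>A\<^esub> f 2"
    unfolding sets by (simp_all add: finsum_insert a_ac)
qed

lemma poisson_cochain_diff:
  assumes x: "x \<in> carrier D" and y: "y \<in> carrier D" and z: "z \<in> carrier D"
  shows "alt_diff A (kahler_lie R A br) 3 (poisson_cochain R A br) [x, y, z] =
    \<ominus>\<^bsub>A\<^esub> coboundary x y z"
proof -
  have cl: "act x (pairing y z) \<in> carrier A" "act y (pairing x z) \<in> carrier A"
    "act z (pairing x y) \<in> carrier A" "pairing (bracket x y) z \<in> carrier A"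
    "pairing (bracket x z) y \<in> carrier A" "pairing (bracket y z) x \<in> carrier A"
    using assms by (simp_all add: act_closed pairing_closed bracket_closed)
  let ?f = "poisson_cochain R A br"
  let ?xs = "[x, y, z]"
  let ?t = "\<lambda>i. signed A i (act (?xs ! i) (?f (omit i ?xs)))"
  let ?s = "\<lambda>k j. signed A (j + k) (?f (bracket (?xs ! j) (?xs ! k) # omit j (omit k ?xs)))"
  have t: "?t 0 = act x (pairing y z)" "?t 1 = \<ominus>\<^bsub>A\<^esub> act y (pairing x z)" "?t 2 = act z (pairing x y)"
    using assms cl by (simp_all add: omit_def poisson_cochain_eq signed_eq)
  have s: "?s 1 0 = \<ominus>\<^bsub>A\<^esub> pairing (bracket x y) z" "?s 2 0 = pairing (bracket x z) y"
    "?s 2 1 = \<ominus>\<^bsub>A\<^esub> pairing (bracket y z) x"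
    using assms cl by (simp_all add: omit_def poisson_cochain_eq bracket_closed signed_eq)
  have "(\<Oplus>\<^bsub>A\<^esub>i\<in>{..<3}. ?t i) =
      act x (pairing y z) \<oplus>\<^bsub>A\<^esub> \<ominus>\<^bsub>A\<^esub> act y (pairing x z) \<oplus>\<^bsub>A\<^esub> act z (pairing x y)"
    by (subst finsum_lessThan_small(4)) (simp_all only: t cl a_inv_closed)
  moreover have inner: "(\<Oplus>\<^bsub>A\<^esub>j\<in>{..<1}. ?s 1 j) = \<ominus>\<^bsub>A\<^esub> pairing (bracket x y) z"
    "(\<Oplus>\<^bsub>A\<^esub>j\<in>{..<2}. ?s 2 j) = pairing (bracket x z) y \<oplus>\<^bsub>A\<^esub> \<ominus>\<^bsub>A\<^esub> pairing (bracket y z) x"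
    using finsum_lessThan_small(2)[of "?s 1"] finsum_lessThan_small(3)[of "?s 2"]
    by (simp_all only: s cl a_inv_closed)
  moreover have "(\<Oplus>\<^bsub>A\<^esub>k\<in>{..<3}. \<Oplus>\<^bsub>A\<^esub>j\<in>{..<k}. ?s k j) = \<zero>\<^bsub>A\<^esub> \<oplus>\<^bsub>A\<^esub>
      \<ominus>\<^bsub>A\<^esub> pairing (bracket x y) z \<oplus>\<^bsub>A\<^esub> (pairing (bracket x z) y \<oplus>\<^bsub>A\<^esub> \<ominus>\<^bsub>A\<^esub> pairing (bracket y z) x)"
    by (subst finsum_lessThan_small(4))
      (simp_all only: finsum_lessThan_small(1) inner cl a_inv_closed a_closed zero_closed)
  moreover have "?xs \<in> tuples D 3" using assms by (auto simp: tuples_3)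
  ultimately show ?thesis
    unfolding alt_diff_def kahler_lie_simps tuples_kahler_lie coboundary_def
    using cl by (simp add: signed_eq minus_eq minus_add a_ac)
qed

lemma poisson_cochain_cocycle: "poisson_cochain R A br \<in> alt_cocycles A (kahler_lie R A br) 2"
proof -
  have "alt_diff A (kahler_lie R A br) 3 (poisson_cochain R A br) xs = \<zero>\<^bsub>A\<^esub>" if "xs \<in> tuples D 3" for xs
    using that by (auto simp: tuples_3 poisson_cochain_diff coboundary_zero)
  moreover have "alt_diff A (kahler_lie R A br) 3 (poisson_cochain R A br) \<in> extensional (tuples D 3)"
    by (simp add: alt_diff_def tuples_kahler_lie)
  ultimately have "alt_diff A (kahler_lie R A br) 3 (poisson_cochain R A br) = (\<lambda>xs\<in>tuples D 3. \<zero>\<^bsub>A\<^esub>)"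
    by (intro extensionalityI[of _ "tuples D 3"]) auto
  then show ?thesis
    using poisson_cochain_alt_form
    by (simp add: alt_cocycles_def alt_forms_def tuples_kahler_lie)
qed

end


section \<open>Naturality\<close>

lemma restrict_scalars_module:
  assumes "cring A" "cring A'" "\<phi> \<in> ring_hom A A'" and N: "module A' N"
  shows "module A \<lparr>carrier = carrier N, mult = undefined, one = undefined, zero = zero N,
    add = add N, smult = (\<lambda>a. smult N (\<phi> a))\<rparr>" (is "module A ?N")
proof -
  interpret N: module A' N by fact
  show ?thesis
  proof (rule moduleI[OF assms(1)])
    show "abelian_group ?N"
    proof (rule abelian_groupI)
      fix x assume "x \<in> carrier ?N"
      then show "\<exists>y\<in>carrier ?N. y \<oplus>\<^bsub>?N\<^esub> x = \<zero>\<^bsub>?N\<^esub>"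
        by (intro bexI[of _ "\<ominus>\<^bsub>N\<^esub> x"]) (simp_all add: N.M.l_neg)
    qed (simp_all add: N.M.a_ac)
  qed (use assms(3) in \<open>simp_all add: ring_hom_closed ring_hom_add ring_hom_mult ring_hom_one
      N.smult_l_distr N.smult_r_distr N.smult_assoc1\<close>)
qed

text \<open>The map \<open>u \<mapsto> d\<phi>(u)\<close> is a derivation into the differentials of \<open>A'\<close>, seen as an \<open>A\<close>-module through \<open>\<phi>\<close>.\<close>

lemma kahler_map_unique:
  fixes A :: "('r, 'a, 'n) module_scheme" and A' :: "('r, 'b, 'k) module_scheme"
  assumes A: "algebra R A" and A': "algebra R A'" and hom: "\<phi> \<in> ring_hom A A'"
    and smult: "\<And>r a. \<lbrakk>r \<in> carrier R; a \<in> carrier A\<rbrakk> \<Longrightarrow> \<phi> (r \<odot>\<^bsub>A\<^esub> a) = r \<odot>\<^bsub>A'\<^esub> \<phi> a"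
  shows "\<exists>!F. F \<in> carrier (kahler R A) \<rightarrow>\<^sub>E carrier (kahler R A') \<and>
      (\<forall>x\<in>carrier (kahler R A). \<forall>y\<in>carrier (kahler R A).
        F (x \<oplus>\<^bsub>kahler R A\<^esub> y) = F x \<oplus>\<^bsub>kahler R A'\<^esub> F y) \<and>
      (\<forall>a\<in>carrier A. \<forall>u\<in>carrier A.
        F (a \<odot>\<^bsub>kahler R A\<^esub> kahler_d R A u) = \<phi> a \<odot>\<^bsub>kahler R A'\<^esub> kahler_d R A' (\<phi> u))"
  (is "\<exists>!F. ?P F")
proof (rule ex_ex1I)
  interpret A: algebra R A by fact
  interpret A': algebra R A' by fact
  interpret D: module A "kahler R A" by (rule A.kahler_module)
  let ?D = "kahler R A" and ?D' = "kahler R A'"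
  let ?N = "\<lparr>carrier = carrier ?D', mult = undefined, one = undefined, zero = zero ?D',
    add = add ?D', smult = (\<lambda>a. smult ?D' (\<phi> a))\<rparr>"
  have N: "module A ?N"
    using A.M_cring A'.M_cring hom A'.kahler_module by (rule restrict_scalars_module)
  have \<phi>: "\<phi> a \<in> carrier A'" if "a \<in> carrier A" for a
    using hom that by (rule ring_hom_closed)
  have "\<exists>k. linear_map A ?D ?N k \<and> (\<forall>u\<in>carrier A. k (kahler_d R A u) = kahler_d R A' (\<phi> u))"
  proof -
    obtain k where "linear_map A ?D ?N k"
      "\<And>u. u \<in> carrier A \<Longrightarrow> k (kahler_d R A u) = kahler_d R A' (\<phi> u)"
      by (rule A.kahler_lift[OF N, of "\<lambda>u. kahler_d R A' (\<phi> u)"])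
        (simp_all add: \<phi> A'.kahler_d_closed A'.kahler_d_derivation smult
          ring_hom_add[OF hom] ring_hom_mult[OF hom] ring_hom_one[OF hom])
    then show ?thesis by blast
  qed
  then obtain k where k: "linear_map A ?D ?N k"
    and kd: "\<forall>u\<in>carrier A. k (kahler_d R A u) = kahler_d R A' (\<phi> u)"
    by blast
  have "?P (restrict k (carrier ?D))"
    using linear_mapD[OF k] kd A.kahler_d_closed by simp
  then show "\<exists>F. ?P F" by (rule exI[where P = ?P])
next
  interpret A: algebra R A by fact
  interpret A': algebra R A' by fact
  interpret D': module A' "kahler R A'" by (rule A'.kahler_module)
  fix F G assume P: "?P F" "?P G"
  note ext = P[THEN conjunct1]
  show "F = G"
  proof (rule PiE_ext[OF ext])
    fix x assume x: "x \<in> carrier (kahler R A)"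
    show "F x = G x"
      by (rule A.kahler_additive_eqI[OF D'.M.abelian_group_axioms x])
        (use P PiE_mem[OF ext(1)] PiE_mem[OF ext(2)] in simp_all)
  qed
qed

text \<open>Both sides are additive in \<open>x\<close> and in \<open>y\<close>, and at \<open>(a du, b dv)\<close> both are \<open>\<phi>(a) \<phi>(b) {\<phi>(u), \<phi>(v)}\<close>.\<close>

lemma poisson_form_natural:
  fixes A :: "('r, 'a, 'n) module_scheme" and A' :: "('r, 'b, 'k) module_scheme"
  assumes A: "poisson_algebra R A br" and A': "poisson_algebra R A' br'"
    and phi: "\<phi> \<in> poisson_hom R A br A' br'"
    and x: "x \<in> carrier (kahler R A)" and y: "y \<in> carrier (kahler R A)"
  shows "\<phi> (poisson_form R A br (ktensor R A x y)) =
    poisson_form R A' br' (ktensor R A' (kahler_map R A A' \<phi> x) (kahler_map R A A' \<phi> y))"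
proof -
  interpret A: poisson_algebra R A br by fact
  interpret A': poisson_algebra R A' br' by fact
  interpret D: module A "kahler R A" by (rule A.kahler_module)
  have hom: "\<phi> \<in> ring_hom A A'"
    and smult: "\<And>r a. \<lbrakk>r \<in> carrier R; a \<in> carrier A\<rbrakk> \<Longrightarrow> \<phi> (r \<odot>\<^bsub>A\<^esub> a) = r \<odot>\<^bsub>A'\<^esub> \<phi> a"
    and bracket: "\<And>a b. \<lbrakk>a \<in> carrier A; b \<in> carrier A\<rbrakk> \<Longrightarrow> \<phi> (br a b) = br' (\<phi> a) (\<phi> b)"
    using phi by (auto simp: poisson_hom_def)
  have \<phi>: "\<phi> a \<in> carrier A'" if "a \<in> carrier A" for a
    using hom that by (rule ring_hom_closed)
  let ?F = "kahler_map R A A' \<phi>"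
  note F_spec = theI'[OF kahler_map_unique[OF A.algebra_axioms A'.algebra_axioms hom smult]]
  have F: "?F x \<in> carrier (kahler R A')" if "x \<in> carrier (kahler R A)" for x
    using F_spec that unfolding kahler_map_def Let_def by (auto simp: PiE_iff)
  have F_add: "?F (x \<oplus>\<^bsub>kahler R A\<^esub> y) = ?F x \<oplus>\<^bsub>kahler R A'\<^esub> ?F y"
    if "x \<in> carrier (kahler R A)" "y \<in> carrier (kahler R A)" for x y
    using F_spec that unfolding kahler_map_def Let_def by auto
  have F_gen: "?F (a \<odot>\<^bsub>kahler R A\<^esub> kahler_d R A u) = \<phi> a \<odot>\<^bsub>kahler R A'\<^esub> kahler_d R A' (\<phi> u)"
    if "a \<in> carrier A" "u \<in> carrier A" for a u
    using F_spec that unfolding kahler_map_def Let_def by auto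
  have "\<phi> (A.pairing x y) = A'.pairing (?F x) (?F y)"
  proof (rule A.kahler_additive_eqI[OF A'.abelian_group_axioms x])
    fix a u assume au: "a \<in> carrier A" "u \<in> carrier A"
    then have adu: "a \<odot>\<^bsub>kahler R A\<^esub> kahler_d R A u \<in> carrier (kahler R A)"
      by (simp add: A.kahler_d_closed)
    show "\<phi> (A.pairing (a \<odot>\<^bsub>kahler R A\<^esub> kahler_d R A u) y) =
        A'.pairing (?F (a \<odot>\<^bsub>kahler R A\<^esub> kahler_d R A u)) (?F y)"
    proof (rule A.kahler_additive_eqI[OF A'.abelian_group_axioms y])
      fix b v assume bv: "b \<in> carrier A" "v \<in> carrier A"
      show "\<phi> (A.pairing (a \<odot>\<^bsub>kahler R A\<^esub> kahler_d R A u) (b \<odot>\<^bsub>kahler R A\<^esub> kahler_d R A v)) =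
          A'.pairing (?F (a \<odot>\<^bsub>kahler R A\<^esub> kahler_d R A u)) (?F (b \<odot>\<^bsub>kahler R A\<^esub> kahler_d R A v))"
        using au bv by (simp add: A.pairing_gen F_gen A'.pairing_gen \<phi> bracket A.br_closed
            ring_hom_mult[OF hom])
    qed (use adu in \<open>simp_all add: A.pairing_closed A'.pairing_closed A.pairing_add_right
          A'.pairing_add_right F F_add \<phi> ring_hom_add[OF hom]\<close>)
  qed (use y in \<open>simp_all add: A.pairing_closed A'.pairing_closed A.pairing_add_left
        A'.pairing_add_left F F_add \<phi> ring_hom_add[OF hom]\<close>)
  then show ?thesis by (simp add: A.pairing_def A'.pairing_def)
qed

theorem lemma3p9:
  fixes R :: "('r, 'm) ring_scheme"
    and A :: "('r, 'a, 'n) module_scheme"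
    and A' :: "('r, 'b, 'k) module_scheme"
  assumes "poisson_algebra R A br"
  shows "is_poisson_form R A br (poisson_form R A br) \<and>
    poisson_cochain R A br \<in> alt_cocycles A (kahler_lie R A br) 2 \<and>
    (poisson_algebra R A' br' \<longrightarrow>
      (\<forall>\<phi>\<in>poisson_hom R A br A' br'. \<forall>\<alpha>\<in>carrier (kahler R A). \<forall>\<beta>\<in>carrier (kahler R A).
        \<phi> (poisson_form R A br (ktensor R A \<alpha> \<beta>)) =
        poisson_form R A' br' (ktensor R A' (kahler_map R A A' \<phi> \<alpha>) (kahler_map R A A' \<phi> \<beta>))))"
  using poisson_algebra.poisson_form[OF assms] poisson_algebra.poisson_cochain_cocycle[OF assms]
    poisson_form_natural[OF assms]
  by blast

end
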